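(* Let $i\in\{4,5,6,7,8\}$. Any irreducible $i$-hedrite has at most $i-2$ central circuits. Moreover, for each $i$ with $4\le i\le 8$, equality is attained: there exists an irreducible $i$-hedrite with exactly $i-2$ central circuits.
   Context: Plane graphs are finite graphs embedded in the plane (equivalently the sphere), multiple edges being allowed; the exterior face counts as a face; a $k$-gon is a face whose boundary has length $k$. For $i\in\{4,5,6,7,8\}$, an $i$-hedrite is a $2$-connected (i.e. connected and without cut-vertex) $4$-valent plane graph all of whose faces are $2$-, $3$- or $4$-gons and which has exactly $8-i$ faces that are $2$-gons (hence $2i-8$ $3$-gons). A central circuit of a $4$-valent plane graph is a closed circuit of edges obtained by starting with an edge and continuing at each vertex by the edge opposite (in the cyclic order of the four edges around the vertex) to the entering one; the central circuits partition the edge-set. A rail-road is a circuit of $4$-gonal faces, possibly self-intersecting (a face may be passed through twice), in which every $4$-gon is adjacent to two of its neighbors (the preceding and the following one in the circuit) on opposite edges. An $i$-hedrite is irreducible if it contains no rail-road. *)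

theory Defs
  imports "Graph_Theory.Graph_Theory" "HOL-Combinatorics.Orbits"
begin

text \<open>
  A connected plane (multi)graph is represented by the combinatorial map of its embedding in the
  oriented sphere. Each edge consists of two mutually reverse arcs \<open>a\<close> and \<open>arev a\<close>, one
  leaving each end of the edge, and \<open>rot a\<close> is the next arc after \<open>a\<close> in the cyclic order
  around \<open>tail G a\<close>. Embeddings of connected graphs in the sphere correspond, up to
  homeomorphism, to the rotation systems of Euler characteristic 2.
\<close>

definition edge :: "('b \<Rightarrow> 'b) \<Rightarrow> 'b \<Rightarrow> 'b set" where
  "edge arev a = {a, arev a}"

definition edges :: "('a, 'b) pre_digraph \<Rightarrow> ('b \<Rightarrow> 'b) \<Rightarrow> 'b set set" where
  "edges G arev = edge arev ` arcs G"

text \<open>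
  \<open>face_step arev rot a\<close> follows \<open>a\<close> on the boundary walk of the face lying on a fixed side
  of \<open>a\<close>. A face is the set of arcs of its boundary walk, so the cardinality of this set is the
  length of the walk: an edge met twice by the walk contributes both of its arcs.
\<close>

definition face_step :: "('b \<Rightarrow> 'b) \<Rightarrow> ('b \<Rightarrow> 'b) \<Rightarrow> 'b \<Rightarrow> 'b" where
  "face_step arev rot a = rot (arev a)"

definition face :: "('b \<Rightarrow> 'b) \<Rightarrow> ('b \<Rightarrow> 'b) \<Rightarrow> 'b \<Rightarrow> 'b set" where
  "face arev rot a = orbit (face_step arev rot) a"

definition faces :: "('a, 'b) pre_digraph \<Rightarrow> ('b \<Rightarrow> 'b) \<Rightarrow> ('b \<Rightarrow> 'b) \<Rightarrow> 'b set set" where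
  "faces G arev rot = face arev rot ` arcs G"

locale connected_plane_graph =
  fin_digraph G + bidirected_digraph G arev
  for G :: "('a, 'b) pre_digraph" (structure) and arev :: "'b \<Rightarrow> 'b" +
  fixes rot :: "'b \<Rightarrow> 'b"
  assumes connected: "connected G"
    and rot_cyclic: "\<And>v. v \<in> verts G \<Longrightarrow> out_arcs G v \<noteq> {} \<Longrightarrow> cyclic_on rot (out_arcs G v)"
    and euler: "int (card (verts G)) - int (card (edges G arev))
                  + int (card (faces G arev rot)) = 2"

text \<open>
  Reachability is symmetric in the graphs considered here, since every arc has a reverse.
\<close>

definition cut_vertex :: "('a, 'b) pre_digraph \<Rightarrow> 'a \<Rightarrow> bool" where
  "cut_vertex G v \<longleftrightarrow> v \<in> verts G \<and>
     (\<exists>u \<in> verts G - {v}. \<exists>w \<in> verts G - {v}.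
        u \<rightarrow>\<^sup>*\<^bsub>G\<^esub> w \<and> \<not> u \<rightarrow>\<^sup>*\<^bsub>pre_digraph.del_vert G v\<^esub> w)"

text \<open>
  The degree of a vertex is its \<open>out_degree\<close>, as a loop has both of its arcs leaving its vertex.
\<close>

locale hedrite = connected_plane_graph G arev rot
  for i :: nat and G :: "('a, 'b) pre_digraph" (structure)
    and arev :: "'b \<Rightarrow> 'b" and rot :: "'b \<Rightarrow> 'b" +
  assumes i_range: "i \<in> {4..8}"
    and no_cut_vertex: "\<And>v. \<not> cut_vertex G v"
    and four_valent: "\<And>v. v \<in> verts G \<Longrightarrow> out_degree G v = 4"
    and face_sizes: "\<And>F. F \<in> faces G arev rot \<Longrightarrow> card F \<in> {2, 3, 4}"
    and card_digons: "card {F \<in> faces G arev rot. card F = 2} = 8 - i"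

text \<open>
  After traversing \<open>a\<close>, leave its head along the arc opposite to \<open>arev a\<close>. An orbit is a central
  circuit with a direction of traversal; its set of edges does not depend on the direction.
\<close>

definition straight_step :: "('b \<Rightarrow> 'b) \<Rightarrow> ('b \<Rightarrow> 'b) \<Rightarrow> 'b \<Rightarrow> 'b" where
  "straight_step arev rot a = rot (rot (arev a))"

definition central_circuit :: "('b \<Rightarrow> 'b) \<Rightarrow> ('b \<Rightarrow> 'b) \<Rightarrow> 'b \<Rightarrow> 'b set set" where
  "central_circuit arev rot a = edge arev ` orbit (straight_step arev rot) a"

definition central_circuits ::
  "('a, 'b) pre_digraph \<Rightarrow> ('b \<Rightarrow> 'b) \<Rightarrow> ('b \<Rightarrow> 'b) \<Rightarrow> 'b set set set" where
  "central_circuits G arev rot = central_circuit arev rot ` arcs G"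

text \<open>
  A passage through a 4-gon is given by the boundary arc \<open>a\<close> through whose edge it enters. The
  opposite boundary arc is reached by two face steps, and the 4-gon across that edge is entered
  through the reverse of that arc. Hence a rail-road, as a cyclic sequence of passages, may
  contain the same face more than once, entered through different edges.
\<close>

definition rail_step :: "('b \<Rightarrow> 'b) \<Rightarrow> ('b \<Rightarrow> 'b) \<Rightarrow> 'b \<Rightarrow> 'b" where
  "rail_step arev rot a = arev (face_step arev rot (face_step arev rot a))"

definition rail_road ::
  "('a, 'b) pre_digraph \<Rightarrow> ('b \<Rightarrow> 'b) \<Rightarrow> ('b \<Rightarrow> 'b) \<Rightarrow> 'b list \<Rightarrow> bool" where
  "rail_road G arev rot as \<longleftrightarrow>
     as \<noteq> [] \<and> distinct as \<and> set as \<subseteq> arcs G \<and>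
     (\<forall>a \<in> set as. card (face arev rot a) = 4) \<and>
     (\<forall>j < length as. as ! (Suc j mod length as) = rail_step arev rot (as ! j))"

definition irreducible_map ::
  "('a, 'b) pre_digraph \<Rightarrow> ('b \<Rightarrow> 'b) \<Rightarrow> ('b \<Rightarrow> 'b) \<Rightarrow> bool" where
  "irreducible_map G arev rot \<longleftrightarrow> \<not> (\<exists>as. rail_road G arev rot as)"

end

theory Submission
  imports Defs
begin

text \<open>
  Dual to the vertices of an \<open>i\<close>-hedrite there are squares, which make the sphere a flat surface with
  one cone point for each of the \<open>i\<close> faces that are not 4-gons. Giving widths to the \<open>z\<close> central
  circuits deforms the flat structure. The space of deformations has complex dimension \<open>i - 2\<close> and
  carries a Hermitian form, the polarized area, which is real on the deformations by widths. These
  form an isotropic real subspace for its imaginary part, so \<open>z \<le> i - 2\<close> once distinct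
  widths are known to give distinct deformations. This is where irreducibility enters: without a
  rail-road, each side of each circuit meets a cone point, so the width of the circuit is determined
  by the distance between two cone points. The inequality is proved below without cohomology, by
  exhibiting two mutually orthogonal families of functions on the arcs and counting dimensions.
  Extremal hedrites were found by a computer search; only the lower bound on their number of
  circuits has to be checked.
\<close>

section \<open>Underdetermined linear systems\<close>

lemma linear_expand:
  fixes L :: "('i \<Rightarrow> real) \<Rightarrow> real"
  assumes add: "\<And>x y. L (\<lambda>i. x i + y i) = L x + L y"
    and scale: "\<And>c x. L (\<lambda>i. c * x i) = c * L x"
    and "finite I" and "\<And>i. i \<notin> I \<Longrightarrow> x i = 0"
  shows "L x = (\<Sum>i\<in>I. x i * L (\<lambda>k. if k = i then 1 else 0))"
  using assms(3,4)
proof (induction I arbitrary: x)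
  case empty
  then show ?case using scale[of 0 x] by (simp add: fun_eq_iff)
next
  case (insert j I)
  let ?d = "\<lambda>k. if k = j then 1 else 0"
  let ?x = "x(j := 0)"
  have "x = (\<lambda>k. ?x k + (\<lambda>k. x j * ?d k) k)" by (auto simp: fun_eq_iff)
  then have "L x = L ?x + L (\<lambda>k. x j * ?d k)" using add by metis
  also have "\<dots> = L ?x + x j * L ?d" by (simp only: scale)
  also have "L ?x = (\<Sum>i\<in>I. ?x i * L (\<lambda>k. if k = i then 1 else 0))"
    by (rule insert.IH) (use insert.prems in auto)
  also have "\<dots> = (\<Sum>i\<in>I. x i * L (\<lambda>k. if k = i then 1 else 0))"
    using insert.hyps by (intro sum.cong) auto
  finally show ?case using insert.hyps by simp
qed

text \<open>Gaussian elimination, one equation at a time: an equation with a nonzero coefficient is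
  solved for that unknown, and an equation whose coefficients all vanish holds for every
  \<open>x\<close>.\<close>

lemma underdetermined_matrix:
  fixes M :: "'j \<Rightarrow> 'i \<Rightarrow> real"
  assumes "finite J" and "finite I" and "card J < card I"
  shows "\<exists>x. (\<exists>i\<in>I. x i \<noteq> 0) \<and> (\<forall>j\<in>J. (\<Sum>i\<in>I. x i * M j i) = 0)"
  using assms
proof (induction J arbitrary: I M)
  case empty
  then obtain i where "i \<in> I" by fastforce
  then show ?case by (intro exI[of _ "\<lambda>_. 1"]) auto
next
  case (insert j J)
  show ?case
  proof (cases "\<forall>i\<in>I. M j i = 0")
    case True
    obtain x where "\<exists>i\<in>I. x i \<noteq> 0" "\<forall>j\<in>J. (\<Sum>i\<in>I. x i * M j i) = 0"
      using insert.IH[of I M] insert.prems insert.hyps by auto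
    with True show ?thesis by (intro exI[of _ x]) auto
  next
    case False
    then obtain p where p: "p \<in> I" "M j p \<noteq> 0" by blast
    let ?I = "I - {p}"
    \<comment> \<open>Row \<open>l\<close> minus the multiple of row \<open>j\<close> that clears
      column \<open>p\<close>.\<close>
    define M' where "M' = (\<lambda>l i. M l i - M l p * M j i / M j p)"
    have "card J < card ?I" using insert p by auto
    then obtain x where x: "\<exists>i\<in>?I. x i \<noteq> 0" "\<forall>l\<in>J. (\<Sum>i\<in>?I. x i * M' l i) = 0"
      using insert.IH[of ?I M'] insert.prems by auto
    \<comment> \<open>The pivot coordinate takes the value that makes equation \<open>j\<close>
      hold.\<close>
    define x' where "x' = x(p := - (\<Sum>i\<in>?I. x i * M j i) / M j p)"
    have split: "(\<Sum>i\<in>I. x' i * M l i)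
        = - (\<Sum>i\<in>?I. x i * M j i) / M j p * M l p + (\<Sum>i\<in>?I. x i * M l i)" for l
    proof -
      have "(\<Sum>i\<in>I. x' i * M l i) = x' p * M l p + (\<Sum>i\<in>?I. x' i * M l i)"
        using p insert.prems by (subst sum.remove[of _ p]) auto
      also have "(\<Sum>i\<in>?I. x' i * M l i) = (\<Sum>i\<in>?I. x i * M l i)"
        by (intro sum.cong) (auto simp: x'_def)
      finally show ?thesis by (simp add: x'_def)
    qed
    have "(\<Sum>i\<in>I. x' i * M l i) = 0" if "l \<in> J" for l
    proof -
      have "0 = (\<Sum>i\<in>?I. x i * M' l i)" using x that by simp
      also have "\<dots> = (\<Sum>i\<in>?I. x i * M l i) - (\<Sum>i\<in>?I. x i * M j i) / M j p * M l p"
        by (simp add: M'_def algebra_simps sum_subtractf sum_distrib_left sum_divide_distrib)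
      finally show ?thesis unfolding split by simp
    qed
    moreover have "(\<Sum>i\<in>I. x' i * M j i) = 0" unfolding split using p by simp
    moreover have "\<exists>i\<in>I. x' i \<noteq> 0" using x(1) by (auto simp: x'_def)
    ultimately show ?thesis by (intro exI[of _ x']) auto
  qed
qed

lemma underdetermined_linear:
  fixes L :: "'j \<Rightarrow> ('i \<Rightarrow> real) \<Rightarrow> real"
  assumes "finite J" and "finite I" and "card J < card I"
    and add: "\<And>j x y. j \<in> J \<Longrightarrow> L j (\<lambda>i. x i + y i) = L j x + L j y"
    and scale: "\<And>j c x. j \<in> J \<Longrightarrow> L j (\<lambda>i. c * x i) = c * L j x"
  obtains x where "\<exists>i\<in>I. x i \<noteq> 0" "\<And>j. j \<in> J \<Longrightarrow> L j x = 0"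
proof -
  obtain x where x: "\<exists>i\<in>I. x i \<noteq> 0"
      "\<forall>j\<in>J. (\<Sum>i\<in>I. x i * L j (\<lambda>k. if k = i then 1 else 0)) = 0"
    using underdetermined_matrix[OF assms(1-3), of "\<lambda>j i. L j (\<lambda>k. if k = i then 1 else 0)"]
    by blast
  \<comment> \<open>The solution is cut off outside \<open>I\<close>: \<open>L j\<close> may depend
    on coordinates there, and \<open>linear_expand\<close> asks for them to vanish.\<close>
  let ?x = "\<lambda>i. if i \<in> I then x i else 0"
  have "L j ?x = 0" if "j \<in> J" for j
    using x(2) that linear_expand[of "L j" I ?x] add scale \<open>finite I\<close> by simp
  moreover have "\<exists>i\<in>I. ?x i \<noteq> 0" using x(1) by auto
  ultimately show thesis by (intro that[of ?x])
qed

section \<open>Orbits and involutions\<close>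

text \<open>A function with \<open>f (P a) = - f a\<close> can be prescribed freely on
  \<open>R\<close> and is then determined on \<open>A\<close>, so \<open>card R\<close> counts its
  degrees of freedom.\<close>

lemma involution_transversal:
  assumes "finite A" and "\<And>a. a \<in> A \<Longrightarrow> P a \<in> A" and "\<And>a. a \<in> A \<Longrightarrow> P (P a) = a"
    and "\<And>a. a \<in> A \<Longrightarrow> P a \<noteq> a"
  obtains R where "R \<subseteq> A" "\<And>a. a \<in> A \<Longrightarrow> P a \<in> R \<longleftrightarrow> a \<notin> R" "card A = 2 * card R"
proof -
  have "\<exists>R\<subseteq>A. (\<forall>a\<in>A. P a \<in> R \<longleftrightarrow> a \<notin> R) \<and> card A = 2 * card R"
    using assms
  proof (induction A rule: finite_psubset_induct)
    case (psubset A)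
    show ?case
    proof (cases "A = {}")
      case False
      then obtain a where a: "a \<in> A" by blast
      let ?A = "A - {a, P a}"
      have sub: "?A \<subset> A" using a by blast
      have "\<exists>R\<subseteq>?A. (\<forall>a\<in>?A. P a \<in> R \<longleftrightarrow> a \<notin> R) \<and> card ?A = 2 * card R"
      proof (rule psubset.IH[OF sub])
        show "P b \<in> ?A" if "b \<in> ?A" for b
          using that psubset.prems a by (metis Diff_iff insert_iff singletonD)
      qed (use psubset.prems in auto)
      then obtain R where R: "R \<subseteq> ?A" "\<forall>a\<in>?A. P a \<in> R \<longleftrightarrow> a \<notin> R" "card ?A = 2 * card R"
        by blast
      have "finite R" using R(1) psubset.hyps finite_subset by blast
      have "card A = card ?A + 2"
      proof -
        have "card {a, P a} = 2" using psubset.prems a by (metis card_2_iff)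
        moreover have "{a, P a} \<subseteq> A" using psubset.prems a by blast
        ultimately show ?thesis
          using card_Diff_subset[of "{a, P a}" A] card_mono[of A "{a, P a}"] psubset.hyps by simp
      qed
      moreover have "card (insert a R) = Suc (card R)" 
      proof -
        have "a \<notin> R" using R(1) by blast
        then show ?thesis using \<open>finite R\<close> by simp
      qed
      moreover have "P b \<in> insert a R \<longleftrightarrow> b \<notin> insert a R" if "b \<in> A" for b
      proof -
        consider "b = a" | "b = P a" | "b \<in> ?A" using \<open>b \<in> A\<close> by blast
        then show ?thesis
        proof cases
          case 3
          then have "P b \<noteq> a" using psubset.prems a by (metis Diff_iff insertCI)
          with 3 show ?thesis using R(2) by auto
        qed (use R(1) psubset.prems a in auto)
      qed
      ultimately show ?thesis using R a by (intro exI[of _ "insert a R"]) auto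
    qed auto
  qed
  then show thesis using that by blast
qed

text \<open>\<open>orbit f x\<close> is generated from \<open>f x\<close>, so membership of
  \<open>x\<close> needs an argument: \<open>f\<close> permutes the finite set \<open>A\<close>,
  hence every point returns.\<close>

lemma self_in_orbit_if_inj_on:
  assumes "finite A" and "f ` A \<subseteq> A" and "inj_on f A" and "x \<in> A"
  shows "x \<in> orbit f x"
proof -
  have "bij_betw f A A" using assms(1-3) by (simp add: bij_betw_def endo_inj_surj)
  then have "perm_restrict f A permutes A"
    by (intro bij_imp_permutes) (auto simp: perm_restrict_def cong: bij_betw_cong)
  then have "x \<in> orbit (perm_restrict f A) x"
    using assms(1) by (intro permutation_self_in_orbit) (auto simp: permutation_permutes)
  moreover have "orbit f x = orbit (perm_restrict f A) x"
    using assms(2,4) by (intro orbit_cong0[of _ A]) (auto simp: perm_restrict_def)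
  ultimately show ?thesis by simp
qed

lemma funpow_card_orbit:
  assumes "x \<in> orbit f x"
  shows "(f ^^ card (orbit f x)) x = x"
proof -
  have "card (orbit f x) = funpow_dist1 f x x"
    unfolding orbit_conv_funpow_dist1[OF assms] card_image[OF inj_on_funpow_dist1[OF assms]] by simp
  then show ?thesis using funpow_dist1_prop[OF assms] by metis
qed

lemma orbit_eq_map_upt:
  assumes "(f ^^ n) x = x" and "0 < n"
  shows "orbit f x = set (map (\<lambda>m. (f ^^ m) x) [0..<n])"
  using orbit_altdef_bounded[OF assms] by auto

lemma orbit_eq_pair: "f (f x) = x \<Longrightarrow> orbit f x = {x, f x}"
  using orbit_eq_map_upt[of 2 f x] by (simp add: numeral_2_eq_2)

text \<open>The orbits partition \<open>A\<close>. With \<open>P F\<close> saying that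
  \<open>F\<close> has \<open>s\<close> elements, this counts faces of length \<open>s\<close> by
  their arcs.\<close>

lemma sum_card_orbits:
  assumes "finite A" and "f ` A \<subseteq> A" and "inj_on f A"
  shows "(\<Sum>F\<in>{F \<in> orbit f ` A. P F}. card F) = card {a \<in> A. P (orbit f a)}"
proof -
  have self: "a \<in> orbit f a" if "a \<in> A" for a
    using self_in_orbit_if_inj_on assms that by metis
  have sub: "orbit f a \<subseteq> A" if "a \<in> A" for a
  proof
    fix b assume "b \<in> orbit f a"
    then show "b \<in> A" using that assms(2) by induct auto
  qed
  have orbit_eq: "orbit f b = orbit f a" if "a \<in> A" "b \<in> orbit f a" for a b
    using that self[of a] by (metis orbit_swap orbit_trans subsetI subset_antisym)
  have eq: "{a \<in> A. P (orbit f a)} = \<Union> {F \<in> orbit f ` A. P F}"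
  proof (intro equalityI subsetI)
    fix a assume "a \<in> {a \<in> A. P (orbit f a)}"
    then show "a \<in> \<Union> {F \<in> orbit f ` A. P F}" using self by auto
  next
    fix a assume "a \<in> \<Union> {F \<in> orbit f ` A. P F}"
    then obtain b where b: "b \<in> A" "a \<in> orbit f b" "P (orbit f b)" by auto
    then show "a \<in> {a \<in> A. P (orbit f a)}" using orbit_eq[OF b(1,2)] sub[OF b(1)] by auto
  qed
  have disj: "disjnt F F'" if F: "F \<in> orbit f ` A" "F' \<in> orbit f ` A" "F \<noteq> F'" for F F'
  proof (rule ccontr)
    assume "\<not> disjnt F F'"
    then obtain a where a: "a \<in> F" "a \<in> F'" by (auto simp: disjnt_def)
    obtain b b' where b: "b \<in> A" "F = orbit f b" "b' \<in> A" "F' = orbit f b'"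
      using F(1,2) by auto
    then have "orbit f a = F" "orbit f a = F'" using a orbit_eq[of b a] orbit_eq[of b' a] by simp_all
    with F(3) show False by simp
  qed
  have "finite F" if "F \<in> orbit f ` A" for F
    using that finite_subset[OF sub assms(1)] by auto
  then have "card (\<Union> {F \<in> orbit f ` A. P F}) = (\<Sum>F\<in>{F \<in> orbit f ` A. P F}. card F)"
    using disj by (intro card_Union_disjoint) (simp_all add: pairwise_def)
  then show ?thesis unfolding eq by simp
qed

lemma card_edge_image:
  assumes "finite A" and "\<And>a. a \<in> A \<Longrightarrow> e a \<in> A" and "\<And>a. a \<in> A \<Longrightarrow> e (e a) = a"
    and "\<And>a. a \<in> A \<Longrightarrow> e a \<noteq> a"
  shows "card A = 2 * card (edge e ` A)"
proof -
  obtain R where R: "R \<subseteq> A" "\<And>a. a \<in> A \<Longrightarrow> e a \<in> R \<longleftrightarrow> a \<notin> R" "card A = 2 * card R"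
    by (rule involution_transversal[of A e]) (use assms in auto)
  have "edge e ` R = edge e ` A"
  proof (intro equalityI subsetI)
    fix x assume "x \<in> edge e ` A"
    then obtain a where a: "a \<in> A" "x = edge e a" by blast
    moreover have "edge e (e a) = edge e a" using assms(3)[OF a(1)] by (auto simp: edge_def)
    ultimately show "x \<in> edge e ` R" using R(2) by (metis image_eqI)
  qed (use R(1) in auto)
  moreover have "inj_on (edge e) R"
    by (rule inj_onI) (metis R(1,2) edge_def doubleton_eq_iff subsetD)
  ultimately show ?thesis using R(3) card_image by metis
qed

lemma card_partition_2_3_4:
  fixes f :: "'a \<Rightarrow> nat"
  assumes "\<And>a. a \<in> A \<Longrightarrow> f a \<in> {2, 3, 4}" and "finite A"
  shows "card A = card {a \<in> A. f a = 2} + card {a \<in> A. f a = 3} + card {a \<in> A. f a = 4}"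
proof -
  have A: "A = {a \<in> A. f a = 2} \<union> {a \<in> A. f a = 3} \<union> {a \<in> A. f a = 4}"
    using assms(1) by auto
  have "card ({a \<in> A. f a = 2} \<union> {a \<in> A. f a = 3} \<union> {a \<in> A. f a = 4})
      = card {a \<in> A. f a = 2} + card {a \<in> A. f a = 3} + card {a \<in> A. f a = 4}"
    using assms(2) by (simp add: card_Un_disjoint disjoint_iff)
  then show ?thesis using arg_cong[OF A, of card] by (rule trans[rotated])
qed

section \<open>Deformations of a hedrite\<close>

context hedrite
begin

section \<open>Rotation and face walks of a 4-valent map\<close>

lemma rot_cyclic_arcs: "cyclic_on rot (out_arcs G (tail G a))" if "a \<in> arcs G"
  using that by (intro rot_cyclic) (auto simp: out_arcs_def)

lemma rot_in_arcs [simp]: "rot a \<in> arcs G" and tail_rot [simp]: "tail G (rot a) = tail G a"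
  if "a \<in> arcs G"
proof -
  have "rot a \<in> out_arcs G (tail G a)"
    using cyclic_on_inI[OF rot_cyclic_arcs[OF that]] that by auto
  then show "rot a \<in> arcs G" "tail G (rot a) = tail G a" by auto
qed

lemma orbit_rot: "orbit rot a = out_arcs G (tail G a)" if "a \<in> arcs G"
  using rot_cyclic_arcs[OF that] that by (auto simp: cyclic_on_alldef)

lemma rot_self_in_orbit: "a \<in> orbit rot a" if "a \<in> arcs G"
  using that by (simp add: orbit_rot)

lemma card_orbit_rot: "card (orbit rot a) = 4" if "a \<in> arcs G"
  using four_valent[of "tail G a"] that by (simp add: orbit_rot out_degree_def)

lemma rot_rot_rot_rot [simp]: "rot (rot (rot (rot a))) = a" if "a \<in> arcs G"
  using funpow_card_orbit[OF rot_self_in_orbit[OF that]] card_orbit_rot[OF that]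
  by (simp add: numeral_eq_Suc)

lemma rot_rot_neq: "rot (rot a) \<noteq> a" if "a \<in> arcs G"
proof
  assume "rot (rot a) = a"
  then have "card (orbit rot a) \<le> 2"
    using orbit_eq_pair[of rot a] card_insert_le_m1[of 2 "{rot a}" a] by simp
  with card_orbit_rot[OF that] show False by simp
qed

lemma inj_on_rot: "inj_on rot (arcs G)"
  by (rule inj_onI) (metis rot_rot_rot_rot)

abbreviation "fstep \<equiv> face_step arev rot"

lemma fstep_in_arcs [simp]: "fstep a \<in> arcs G" if "a \<in> arcs G"
  using that by (simp add: face_step_def)

lemma inj_on_fstep: "inj_on fstep (arcs G)"
proof (rule inj_onI)
  fix a b assume ab: "a \<in> arcs G" "b \<in> arcs G" "fstep a = fstep b"
  then have "arev a = arev b" using inj_onD[OF inj_on_rot] by (simp add: face_step_def)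
  then show "a = b" by (metis arev_arev)
qed

lemma fstep_self_in_orbit: "a \<in> face arev rot a" if "a \<in> arcs G"
  unfolding face_def using that inj_on_fstep
  by (intro self_in_orbit_if_inj_on[of "arcs G"]) auto

lemma face_eq: "face arev rot b = face arev rot a" if "a \<in> arcs G" "b \<in> face arev rot a"
  using that fstep_self_in_orbit[of a] unfolding face_def
  by (metis orbit_swap orbit_trans subsetI subset_antisym)

section \<open>Reindexing sums over arcs, and orthogonality of displacements\<close>

lemma sum_rot: "(\<Sum>a\<in>arcs G. f (rot a)) = (\<Sum>a\<in>arcs G. f a)"
  by (rule sum.reindex_bij_witness[of _ "\<lambda>a. rot (rot (rot a))" rot]) auto

lemma sum_arev: "(\<Sum>a\<in>arcs G. f (arev a)) = (\<Sum>a\<in>arcs G. f a)"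
  by (rule sum.reindex_bij_witness[of _ arev arev]) auto

text \<open>A sum over arcs meets each edge from both ends; against a factor symmetric under
  \<open>arev\<close>, both ends contribute equally.\<close>

lemma sum_arev_symmetric:
  fixes f g :: "'b \<Rightarrow> real"
  assumes "\<And>a. a \<in> arcs G \<Longrightarrow> g (arev a) = g a"
  shows "(\<Sum>a\<in>arcs G. (f a + f (arev a)) * g a) = 2 * (\<Sum>a\<in>arcs G. f a * g a)"
proof -
  have "(\<Sum>a\<in>arcs G. f (arev a) * g a) = (\<Sum>a\<in>arcs G. f (arev a) * g (arev a))"
    using assms by simp
  also have "\<dots> = (\<Sum>a\<in>arcs G. f a * g a)" by (rule sum_arev)
  finally show ?thesis by (simp add: algebra_simps sum.distrib)
qed

text \<open>
  Cut the sphere into the squares dual to the vertices, and let the circuit \<open>C\<close> acquire width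
  \<open>m C\<close>. Vectors are recorded by their component along each arc \<open>a\<close>: a vector at a vertex is a
  function with \<open>u (rot (rot a)) = - u a\<close>, a vector at a face is a function with
  \<open>y (fstep (fstep a)) = - y a\<close>, which vanishes on 2-gons and 3-gons. Then
  \<open>(- (y a + y (arev a)), y (rot a) + y (rot (arev a)) + m a)\<close> is the displacement across \<open>a\<close> of
  a closed deformation. The second family, made of \<open>u\<close> and \<open>k\<close>, consists of the functionals given
  by the closing condition at each vertex and by the component along a circuit, summed over that
  circuit; the latter vanish since the widths have no component along the circuit.
\<close>

lemma displacement_orthogonal:
  fixes y u m k :: "'b \<Rightarrow> real"
  assumes y: "\<And>a. a \<in> arcs G \<Longrightarrow> y (fstep (fstep a)) = - y a"
    and u: "\<And>a. a \<in> arcs G \<Longrightarrow> u (rot (rot a)) = - u a"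
    and m: "\<And>a. a \<in> arcs G \<Longrightarrow> m (arev a) = m a" "\<And>a. a \<in> arcs G \<Longrightarrow> m (rot (rot a)) = m a"
    and k: "\<And>a. a \<in> arcs G \<Longrightarrow> k (arev a) = k a" "\<And>a. a \<in> arcs G \<Longrightarrow> k (rot (rot a)) = k a"
  shows "(\<Sum>a\<in>arcs G. (y a + y (arev a)) * (u a + u (arev a) + k (rot a) + k (rot (arev a))))
       = (\<Sum>a\<in>arcs G. (y (rot a) + y (rot (arev a)) + m a) * (u (rot a) + u (rot (arev a))))"
    (is "?l = ?r")
proof -
  \<comment> \<open>Reindexing by \<open>rot\<close> twice fixes \<open>m\<close> and negates
    \<open>u\<close>, so the sum equals its own negative.\<close>
  have mu: "(\<Sum>a\<in>arcs G. m a * u (rot a)) = 0"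
  proof -
    have "(\<Sum>a\<in>arcs G. m a * u (rot a))
        = (\<Sum>a\<in>arcs G. m (rot (rot a)) * u (rot (rot (rot a))))"
      by (rule sum_rot[of "\<lambda>a. m (rot a) * u (rot (rot a))", symmetric, THEN trans[rotated]])
         (rule sum_rot[of "\<lambda>a. m a * u (rot a)", symmetric])
    also have "\<dots> = (\<Sum>a\<in>arcs G. - (m a * u (rot a)))"
      using m(2) u by (intro sum.cong) auto
    finally show ?thesis by (simp add: sum_negf)
  qed
  \<comment> \<open>Reindexing by two face steps negates \<open>y\<close> and carries
    \<open>k (rot a)\<close> to \<open>k (rot (arev a))\<close>, since opposite and reverse arcs
    share \<open>k\<close>. The two summands therefore cancel.\<close>
  have yk: "(\<Sum>a\<in>arcs G. y a * (k (rot a) + k (rot (arev a)))) = 0"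
  proof -
    have "(\<Sum>a\<in>arcs G. y a * k (rot a))
        = (\<Sum>a\<in>arcs G. y (fstep (fstep a)) * k (rot (fstep (fstep a))))"
      using sum_rot[of "\<lambda>a. y a * k (rot a)"]
        sum_arev[of "\<lambda>a. y (rot a) * k (rot (rot a))"]
        sum_rot[of "\<lambda>a. y (fstep a) * k (rot (fstep a))"]
        sum_arev[of "\<lambda>a. y (fstep (rot a)) * k (rot (fstep (rot a)))"]
      by (simp add: face_step_def)
    also have "\<dots> = (\<Sum>a\<in>arcs G. - (y a * k (rot (arev a))))"
    proof (intro sum.cong refl)
      fix a assume a: "a \<in> arcs G"
      have "k (rot (fstep (fstep a))) = k (arev (fstep a))"
        using a k(2)[of "arev (fstep a)"] by (simp add: face_step_def)
      also have "\<dots> = k (rot (arev a))" using a k(1)[of "fstep a"] by (simp add: face_step_def)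
      finally show "y (fstep (fstep a)) * k (rot (fstep (fstep a))) = - (y a * k (rot (arev a)))"
        using y[OF a] by simp
    qed
    finally show ?thesis by (simp add: algebra_simps sum.distrib sum_negf)
  qed
  \<comment> \<open>Again two steps along the face: \<open>y\<close> and \<open>u\<close> both
    change sign, and the signs cancel.\<close>
  have yu: "(\<Sum>a\<in>arcs G. y (rot a) * u (rot (arev a))) = (\<Sum>a\<in>arcs G. y a * u (arev a))"
  proof -
    have "(\<Sum>a\<in>arcs G. y (rot a) * u (rot (arev a)))
        = (\<Sum>a\<in>arcs G. y (fstep a) * u (rot a))"
      using sum_arev[of "\<lambda>a. y (rot a) * u (rot (arev a))"] by (simp add: face_step_def)
    also have "\<dots> = (\<Sum>a\<in>arcs G. y (fstep (fstep a)) * u (rot (fstep a)))"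
      using sum_rot[of "\<lambda>a. y (fstep a) * u (rot a)"]
        sum_arev[of "\<lambda>a. y (fstep (rot a)) * u (rot (rot a))"] by (simp add: face_step_def)
    also have "\<dots> = (\<Sum>a\<in>arcs G. y a * u (arev a))"
      using y u by (intro sum.cong refl) (simp add: face_step_def)
    finally show ?thesis .
  qed
  have yy: "(\<Sum>a\<in>arcs G. y (rot a) * u (rot a)) = (\<Sum>a\<in>arcs G. y a * u a)"
    by (rule sum_rot)
  \<comment> \<open>Both sides are first reduced to one end of each edge; \<open>yk\<close> removes
    \<open>k\<close>, \<open>yy\<close> and \<open>yu\<close> pass to the rotated components, and
    \<open>mu\<close> allows \<open>m\<close> to be added.\<close>
  have "?l = 2 * (\<Sum>a\<in>arcs G. y a * (u a + u (arev a) + k (rot a) + k (rot (arev a))))"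
    by (rule sum_arev_symmetric) auto
  also have "\<dots> = 2 * (\<Sum>a\<in>arcs G. y a * (u a + u (arev a)))"
    using yk by (simp add: algebra_simps sum.distrib)
  also have "\<dots> = 2 * (\<Sum>a\<in>arcs G. y (rot a) * (u (rot a) + u (rot (arev a))))"
    using yy yu by (simp add: algebra_simps sum.distrib)
  also have "\<dots> = (\<Sum>a\<in>arcs G. (y (rot a) + y (rot (arev a))) * (u (rot a) + u (rot (arev a))))"
    by (rule sum_arev_symmetric[of _ "\<lambda>a. y (rot a)", symmetric]) auto
  also have "(\<Sum>a\<in>arcs G. m a * (u (rot a) + u (rot (arev a)))) = 0"
  proof -
    have "(\<Sum>a\<in>arcs G. (u (rot a) + u (rot (arev a))) * m a) = 2 * (\<Sum>a\<in>arcs G. u (rot a) * m a)"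
      using m by (intro sum_arev_symmetric) auto
    then show ?thesis using mu by (simp add: mult.commute)
  qed
  then have "(\<Sum>a\<in>arcs G. (y (rot a) + y (rot (arev a))) * (u (rot a) + u (rot (arev a)))) = ?r"
    by (simp add: algebra_simps sum.distrib)
  finally show ?thesis .
qed

text \<open>On a 2-gon one double step returns to \<open>a\<close> with the sign reversed; on a
  3-gon three double steps do.\<close>

lemma face_section_zero:
  fixes y :: "'b \<Rightarrow> real"
  assumes y: "\<And>a. a \<in> arcs G \<Longrightarrow> y (fstep (fstep a)) = - y a"
    and a: "a \<in> arcs G" and "card (face arev rot a) \<noteq> 4"
  shows "y a = 0"
proof -
  have "card (face arev rot a) = 2 \<or> card (face arev rot a) = 3"
    using face_sizes[of "face arev rot a"] assms by (auto simp: faces_def)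
  moreover have "(fstep ^^ card (face arev rot a)) a = a"
    using funpow_card_orbit fstep_self_in_orbit[OF a] unfolding face_def by metis
  ultimately consider "fstep (fstep a) = a" | "fstep (fstep (fstep a)) = a"
    by (auto simp: numeral_eq_Suc)
  then show ?thesis
  proof cases
    case 1
    then show ?thesis using y[OF a] by simp
  next
    case 2
    then show ?thesis using y[OF a] y[of "fstep a"] y[of "fstep (fstep a)"] a by simp
  qed
qed

section \<open>Rails and injectivity of the two families\<close>

abbreviation "rstep \<equiv> rail_step arev rot"

lemma rstep_in_arcs [simp]: "rstep a \<in> arcs G" if "a \<in> arcs G"
  using that by (simp add: rail_step_def)

lemma inj_on_rstep: "inj_on rstep (arcs G)"
  unfolding rail_step_def using inj_on_fstep
  by (auto simp: inj_on_def) (metis arev_arev fstep_in_arcs)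

text \<open>If the rail from \<open>a\<close> met only 4-gons, one period of its orbit under
  \<open>rstep\<close> would be a rail-road.\<close>

lemma singular_face_on_rail:
  assumes irr: "irreducible_map G arev rot" and a: "a \<in> arcs G"
  obtains n where "(rstep ^^ n) a \<in> arcs G" "card (face arev rot ((rstep ^^ n) a)) \<noteq> 4"
proof (rule ccontr)
  assume "\<not> thesis"
  have in_arcs: "(rstep ^^ n) a \<in> arcs G" for n by (induction n) (use a in auto)
  have four: "card (face arev rot ((rstep ^^ n) a)) = 4" for n
    using \<open>\<not> thesis\<close> that in_arcs by blast
  have self: "a \<in> orbit rstep a"
    using inj_on_rstep a by (intro self_in_orbit_if_inj_on[of "arcs G"]) auto
  \<comment> \<open>The first positive return time: minimality makes the list distinct, and
    returning to \<open>a\<close> closes it up.\<close>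
  define p where "p = funpow_dist1 rstep a a"
  have "p > 0" by (simp add: p_def)
  have p: "(rstep ^^ p) a = a" unfolding p_def by (rule funpow_dist1_prop[OF self])
  let ?as = "map (\<lambda>n. (rstep ^^ n) a) [0..<p]"
  have "?as ! (Suc j mod length ?as) = rstep (?as ! j)" if "j < length ?as" for j
  proof (cases "Suc j = p")
    case True
    have "rstep (?as ! j) = (rstep ^^ Suc j) a" using that by simp
    also have "\<dots> = a" using True p by simp
    finally show ?thesis using True \<open>p > 0\<close> by simp
  qed (use that in auto)
  moreover have "distinct ?as"
    using inj_on_funpow_dist1[OF self, folded p_def] by (simp add: distinct_map)
  ultimately have "rail_road G arev rot ?as"
    using \<open>p > 0\<close> in_arcs four unfolding rail_road_def by auto
  with irr show False by (auto simp: irreducible_map_def)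
qed

text \<open>A rail step is a double face step followed by a reversal. Each negates \<open>y\<close>,
  so \<open>y\<close> is constant along the rail, and irreducibility brings the rail to a face where
  \<open>y\<close> vanishes.\<close>

lemma balanced_face_section_zero:
  fixes y :: "'b \<Rightarrow> real"
  assumes y: "\<And>a. a \<in> arcs G \<Longrightarrow> y (fstep (fstep a)) = - y a"
    and y_arev: "\<And>a. a \<in> arcs G \<Longrightarrow> y (arev a) = - y a"
    and irr: "irreducible_map G arev rot" and a: "a \<in> arcs G"
  shows "y a = 0"
proof -
  obtain n where n: "(rstep ^^ n) a \<in> arcs G" "card (face arev rot ((rstep ^^ n) a)) \<noteq> 4"
    using singular_face_on_rail[OF irr a] .
  have "(rstep ^^ n) a \<in> arcs G \<and> y ((rstep ^^ n) a) = y a" for n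
    by (induction n) (use a y y_arev in \<open>auto simp: rail_step_def\<close>)
  with face_section_zero[of y, OF y n] show ?thesis by simp
qed

text \<open>Injectivity of the first family, by linearity: the first equation says that
  \<open>y\<close> is balanced, so \<open>y\<close> vanishes, and then the second leaves only
  \<open>m\<close>.\<close>

lemma face_displacement_injective:
  fixes y m :: "'b \<Rightarrow> real"
  assumes y: "\<And>a. a \<in> arcs G \<Longrightarrow> y (fstep (fstep a)) = - y a"
    and eqs: "\<And>a. a \<in> arcs G \<Longrightarrow> y a + y (arev a) = 0"
      "\<And>a. a \<in> arcs G \<Longrightarrow> y (rot a) + y (rot (arev a)) + m a = 0"
    and irr: "irreducible_map G arev rot" and a: "a \<in> arcs G"
  shows "y a = 0" and "m a = 0"
proof -
  have z: "y a = 0" if "a \<in> arcs G" for a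
    using balanced_face_section_zero[of y, OF y _ irr that] eqs(1) by (simp add: eq_neg_iff_add_eq_0 add.commute)
  then show "y a = 0" "m a = 0" using a eqs(2)[OF a] by auto
qed

text \<open>
  Read \<open>u\<close> as the displacement of the centre of each square and \<open>k\<close> as half the width of each
  circuit. Then \<open>u a + k (rot a)\<close> is the component along \<open>a\<close> of the displacement of a corner, and
  the hypotheses say that the corners meeting at a face agree.
\<close>

lemma vertex_displacement_injective:
  fixes u k :: "'b \<Rightarrow> real"
  assumes u: "\<And>a. a \<in> arcs G \<Longrightarrow> u (rot (rot a)) = - u a"
    and k: "\<And>a. a \<in> arcs G \<Longrightarrow> k (arev a) = k a" "\<And>a. a \<in> arcs G \<Longrightarrow> k (rot (rot a)) = k a"
    and eqs: "\<And>a. a \<in> arcs G \<Longrightarrow> u a + u (arev a) + k (rot a) + k (rot (arev a)) = 0"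
      "\<And>a. a \<in> arcs G \<Longrightarrow> u (rot a) + u (rot (arev a)) = 0"
    and irr: "irreducible_map G arev rot" and a: "a \<in> arcs G"
  shows "u a = 0" and "k a = 0"
proof -
  define y where "y = (\<lambda>a. u a + k (rot a))"
  have arev: "y (arev a) = - y a" if "a \<in> arcs G" for a
    using eqs(1)[OF that] by (simp add: y_def)
  have step: "y (fstep a) = k a - u (rot a)" if "a \<in> arcs G" for a
    using that eqs(2)[OF that] k by (simp add: y_def face_step_def)
  have "y (fstep (fstep a)) = - y a" if "a \<in> arcs G" for a
    using that step[of "fstep a"] u[of "arev a"] eqs(1)[OF that]
    by (simp add: y_def face_step_def)
  then have zero: "y a = 0" if "a \<in> arcs G" for a
    using balanced_face_section_zero[of y, OF _ arev irr that] by blast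
  \<comment> \<open>At opposite arcs \<open>y\<close> takes the values
    \<open>u a + k (rot a)\<close> and \<open>- u a + k (rot a)\<close>; both vanish, which
    separates \<open>u\<close> from \<open>k\<close>.\<close>
  have "u a = 0" "k (rot a) = 0" if "a \<in> arcs G" for a
    using zero[OF that] zero[of "rot (rot a)"] u[OF that] k(2)[of "rot a"] that
    by (auto simp: y_def)
  from this(1)[OF a] this(2)[of "rot (rot (rot a))"] show "u a = 0" "k a = 0" using a by auto
qed

section \<open>Counting arcs, edges and 4-gons\<close>

lemma card_arcs_eq_verts: "card (arcs G) = 4 * card (verts G)"
proof -
  have "card (\<Union>v\<in>verts G. out_arcs G v) = (\<Sum>v\<in>verts G. card (out_arcs G v))"
    by (rule card_UN_disjoint) auto
  moreover have "(\<Union>v\<in>verts G. out_arcs G v) = arcs G" by auto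
  ultimately show ?thesis using four_valent by (simp add: out_degree_def)
qed

lemma card_arcs_eq_edges: "card (arcs G) = 2 * card (edges G arev)"
  unfolding edges_def by (rule card_edge_image) (use arev_neq in auto)

text \<open>With \<open>n\<close> vertices there are \<open>2 * n\<close> edges and, by Euler,
  \<open>n + 2\<close> faces. Together with the \<open>8 - i\<close> 2-gons and the total boundary
  length \<open>4 * n\<close>, this leaves \<open>n + 2 - i\<close> 4-gons.\<close>

lemma card_quadrangles:
  "int (card {a \<in> arcs G. card (face arev rot a) = 4}) = 4 * (int (card (verts G)) + 2 - int i)"
proof -
  define N where "N = (\<lambda>s. card {F \<in> faces G arev rot. card F = s})"
  have fin: "finite (faces G arev rot)" by (simp add: faces_def)
  have "s * N s = card {a \<in> arcs G. card (face arev rot a) = s}" for s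
    using sum_card_orbits[of "arcs G" fstep "\<lambda>F. card F = s"] inj_on_fstep
    by (auto simp: N_def faces_def face_def[abs_def] mult.commute image_subset_iff)
  note N = this
  have "card (arcs G) = 2 * N 2 + 3 * N 3 + 4 * N 4"
    unfolding N by (rule card_partition_2_3_4) (use face_sizes in \<open>auto simp: faces_def\<close>)
  moreover have "card (faces G arev rot) = N 2 + N 3 + N 4"
    unfolding N_def by (rule card_partition_2_3_4) (use face_sizes fin in auto)
  moreover have "N 2 = 8 - i" using card_digons by (simp add: N_def)
  moreover have "i \<le> 8" using i_range by simp
  ultimately show ?thesis
    using euler card_arcs_eq_edges card_arcs_eq_verts N[of 4] by (simp add: of_nat_diff)
qed

section \<open>Independence of central circuits from the direction of traversal\<close>

lemma straight_step_in_arcs: "straight_step arev rot a \<in> arcs G" if "a \<in> arcs G"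
  using that by (simp add: straight_step_def)

lemma straight_self_in_orbit: "a \<in> orbit (straight_step arev rot) a" if "a \<in> arcs G"
proof (rule self_in_orbit_if_inj_on[of "arcs G"])
  show "inj_on (straight_step arev rot) (arcs G)"
  proof (rule inj_onI)
    fix a b assume ab: "a \<in> arcs G" "b \<in> arcs G" "straight_step arev rot a = straight_step arev rot b"
    then have "arev a = arev b"
      using inj_onD[OF inj_on_rot, of "rot (arev a)" "rot (arev b)"]
        inj_onD[OF inj_on_rot, of "arev a" "arev b"] by (simp add: straight_step_def)
    then show "a = b" by (metis arev_arev)
  qed
qed (use that straight_step_in_arcs in auto)

lemma central_circuit_straight:
  "central_circuit arev rot (straight_step arev rot a) = central_circuit arev rot a"
  if "a \<in> arcs G"
  using self_in_orbit_step[OF straight_self_in_orbit[OF that]] by (simp add: central_circuit_def)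

text \<open>Conjugating the straight step by \<open>arev\<close> inverts it, so the circuit of
  \<open>arev a\<close> runs backwards through the reverses of the arcs in the orbit of
  \<open>a\<close>.\<close>

lemma central_circuit_arev_subset:
  assumes a: "a \<in> arcs G"
  shows "central_circuit arev rot (arev a) \<subseteq> central_circuit arev rot a"
proof -
  let ?O = "orbit (straight_step arev rot) a"
  have O_arcs: "b \<in> arcs G" if "b \<in> ?O" for b
    using that by induct (use a in \<open>auto intro: straight_step_in_arcs\<close>)
  have pred: "arev (straight_step arev rot (arev b)) \<in> ?O" if "b \<in> ?O" for b
  proof -
    have self: "b \<in> orbit (straight_step arev rot) b"
      using straight_self_in_orbit O_arcs[OF that] by blast
    \<comment> \<open>The predecessor of \<open>b\<close> on its cycle; in the base case
      \<open>b\<close> is a fixed point and is its own predecessor.\<close>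
    from self obtain c where c: "c \<in> orbit (straight_step arev rot) b" "b = straight_step arev rot c"
    proof cases
      case base
      show ?thesis by (rule that[OF self base])
    next
      case (step c)
      show ?thesis by (rule that[OF step(2,1)])
    qed
    have "c \<in> ?O" using c(1) that by (rule orbit_trans)
    moreover have "arev (straight_step arev rot (arev b)) = c"
      using O_arcs[OF \<open>c \<in> ?O\<close>] unfolding c(2) by (simp add: straight_step_def)
    ultimately show ?thesis by simp
  qed
  have rev: "arev b \<in> ?O" if "b \<in> orbit (straight_step arev rot) (arev a)" for b
    using that
  proof induct
    case base
    show ?case by (rule pred[OF straight_self_in_orbit[OF a]])
  next
    case (step b)
    then show ?case using pred[of "arev b"] by simp
  qed
  have "edge arev b = edge arev (arev b)" for b by (auto simp: edge_def)
  then show ?thesis unfolding central_circuit_def by (intro image_subsetI) (metis rev image_eqI)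
qed

lemma central_circuit_arev:
  "central_circuit arev rot (arev a) = central_circuit arev rot a" if "a \<in> arcs G"
  using central_circuit_arev_subset[OF that] central_circuit_arev_subset[of "arev a"] that by auto

text \<open>\<open>rot (rot a)\<close> is the straight step from \<open>arev a\<close>.\<close>

lemma central_circuit_rot_rot:
  "central_circuit arev rot (rot (rot a)) = central_circuit arev rot a" if "a \<in> arcs G"
  using central_circuit_straight[of "arev a"] central_circuit_arev[OF that] that
  by (simp add: straight_step_def)

text \<open>If there were more circuits, the parameters of the two families would outnumber the
  equations making a member of one agree with a member of the other, up to a sign in the second
  component. Orthogonality forces such a common member to be zero, and injectivity then kills all
  its parameters.\<close>

theorem card_central_circuits_le:
  assumes irr: "irreducible_map G arev rot"
  shows "card (central_circuits G arev rot) \<le> i - 2"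
proof (rule ccontr)
  assume gt: "\<not> card (central_circuits G arev rot) \<le> i - 2"
  let ?A = "arcs G" and ?Z = "central_circuits G arev rot"
  let ?c = "central_circuit arev rot"
  let ?Q = "{a \<in> arcs G. card (face arev rot a) = 4}"
  have face_f: "face arev rot (fstep a) = face arev rot a" if "a \<in> ?A" for a
    using that by (intro face_eq) (auto simp: face_def intro: orbit.base)
  have f4: "fstep (fstep (fstep (fstep a))) = a" if "a \<in> ?Q" for a
    using funpow_card_orbit[of a fstep] fstep_self_in_orbit[of a] that
    by (simp add: face_def numeral_eq_Suc)
  have f2: "fstep (fstep a) \<noteq> a" if "a \<in> ?Q" for a
  proof
    assume "fstep (fstep a) = a"
    then have "card (face arev rot a) \<le> 2"
      using orbit_eq_pair[of fstep a] card_insert_le_m1[of 2 "{fstep a}" a] by (simp add: face_def)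
    with that show False by simp
  qed
  \<comment> \<open>One arc from each pair of opposite sides of a 4-gon, to carry the free values of
    \<open>y\<close>; \<open>U\<close> does the same for \<open>u\<close> at the vertices.\<close>
  obtain Y where Y: "Y \<subseteq> ?Q" "\<And>a. a \<in> ?Q \<Longrightarrow> fstep (fstep a) \<in> Y \<longleftrightarrow> a \<notin> Y" "card ?Q = 2 * card Y"
    by (rule involution_transversal[of ?Q "\<lambda>a. fstep (fstep a)"]) (use f4 f2 face_f in auto)
  obtain U where U: "U \<subseteq> ?A" "\<And>a. a \<in> ?A \<Longrightarrow> rot (rot a) \<in> U \<longleftrightarrow> a \<notin> U" "card ?A = 2 * card U"
    by (rule involution_transversal[of ?A "\<lambda>a. rot (rot a)"]) (use rot_rot_neq in auto)
  \<comment> \<open>One arc per edge: the displacements are symmetric under \<open>arev\<close>, so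
    the equations are imposed only there.\<close>
  obtain E where E: "E \<subseteq> ?A" "\<And>a. a \<in> ?A \<Longrightarrow> arev a \<in> E \<longleftrightarrow> a \<notin> E" "card ?A = 2 * card E"
    by (rule involution_transversal[of ?A arev]) (use arev_neq in auto)
  have fin: "finite Y" "finite U" "finite E" "finite ?Z"
    using finite_subset[OF Y(1)] finite_subset[OF U(1)] finite_subset[OF E(1)]
    by (auto simp: central_circuits_def)
  \<comment> \<open>The vector \<open>x\<close> holds, in this order, the values of \<open>y\<close>
    on \<open>Y\<close>, of \<open>u\<close> on \<open>U\<close>, and of \<open>m\<close> and
    \<open>k\<close> on the circuits.\<close>
  define y where "y = (\<lambda>x :: ('b + 'b) + ('b set set + 'b set set) \<Rightarrow> real. \<lambda>a. if a \<in> ?Q then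
      if a \<in> Y then x (Inl (Inl a)) else - x (Inl (Inl (fstep (fstep a)))) else 0)"
  define u where "u = (\<lambda>x :: ('b + 'b) + ('b set set + 'b set set) \<Rightarrow> real. \<lambda>a.
      if a \<in> U then x (Inl (Inr a)) else - x (Inl (Inr (rot (rot a)))))"
  define m where "m = (\<lambda>x :: ('b + 'b) + ('b set set + 'b set set) \<Rightarrow> real. \<lambda>a. x (Inr (Inl (?c a))))"
  define k where "k = (\<lambda>x :: ('b + 'b) + ('b set set + 'b set set) \<Rightarrow> real. \<lambda>a. x (Inr (Inr (?c a))))"
  have y_add: "y (\<lambda>i. x i + x' i) a = y x a + y x' a" and y_scale: "y (\<lambda>i. c * x i) a = c * y x a"
    and u_add: "u (\<lambda>i. x i + x' i) a = u x a + u x' a" and u_scale: "u (\<lambda>i. c * x i) a = c * u x a"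
    and m_add: "m (\<lambda>i. x i + x' i) a = m x a + m x' a" and m_scale: "m (\<lambda>i. c * x i) a = c * m x a"
    and k_add: "k (\<lambda>i. x i + x' i) a = k x a + k x' a" and k_scale: "k (\<lambda>i. c * x i) a = c * k x a"
    for x x' a c by (simp_all add: y_def u_def m_def k_def)
  define g where "g = (\<lambda>x a. u x a + u x (arev a) + k x (rot a) + k x (rot (arev a)))"
  define h where "h = (\<lambda>x a. u x (rot a) + u x (rot (arev a)))"
  \<comment> \<open>The opposite signs in the two cases are what turns orthogonality into a sum of
    squares equal to minus a sum of squares.\<close>
  define L where "L = (\<lambda>j x. case j of
      Inl a \<Rightarrow> g x a - (y x a + y x (arev a))
    | Inr a \<Rightarrow> h x a + (y x (rot a) + y x (rot (arev a)) + m x a))"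
  let ?I = "(Y <+> U) <+> (?Z <+> ?Z)"
  \<comment> \<open>For \<open>n\<close> vertices there are \<open>4 * n\<close> equations, and
    \<open>2 * (n + 2 - i) + 2 * n\<close> unknowns besides two for each circuit.\<close>
  have "card (E <+> E) < card ?I"
  proof -
    have "int (card ?A) = 4 * int (card (verts G))" using card_arcs_eq_verts by simp
    then have "int (card E) = 2 * int (card (verts G))" "int (card U) = 2 * int (card (verts G))"
      using E(3) U(3) by auto
    moreover have "int (card Y) = 2 * (int (card (verts G)) + 2 - int i)"
      using card_quadrangles Y(3) by linarith
    moreover have "int (card ?Z) > int i - 2" using gt by linarith
    ultimately show ?thesis using fin by (simp add: card_Plus)
  qed
  moreover have "L j (\<lambda>i. x i + x' i) = L j x + L j x'" for j x x'
    by (cases j) (simp_all add: L_def g_def h_def y_add u_add m_add k_add)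
  moreover have "L j (\<lambda>i. c * x i) = c * L j x" for j c x
    by (cases j) (simp_all add: L_def g_def h_def y_scale u_scale m_scale k_scale algebra_simps)
  ultimately obtain x where x: "\<exists>i\<in>?I. x i \<noteq> 0" "\<And>j. j \<in> E <+> E \<Longrightarrow> L j x = 0"
    using fin by (elim underdetermined_linear[of "E <+> E" ?I L, rotated 2]) auto
  have y: "y x (fstep (fstep a)) = - y x a" if "a \<in> ?A" for a
    using Y(2)[of a] f4[of a] face_f that by (auto simp: y_def)
  have u: "u x (rot (rot a)) = - u x a" if "a \<in> ?A" for a
    using U(2)[of a] that by (auto simp: u_def)
  have m: "m x (arev a) = m x a" "m x (rot (rot a)) = m x a"
    and k: "k x (arev a) = k x a" "k x (rot (rot a)) = k x a" if "a \<in> ?A" for a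
    using that by (auto simp: m_def k_def central_circuit_arev central_circuit_rot_rot)
  have eq: "g x a = y x a + y x (arev a)" "h x a = - (y x (rot a) + y x (rot (arev a)) + m x a)"
    if a: "a \<in> ?A" for a
  proof -
    have "a \<in> E \<or> arev a \<in> E" using E(2)[OF a] by blast
    then have "L (Inl a) x = 0 \<and> L (Inr a) x = 0 \<or> L (Inl (arev a)) x = 0 \<and> L (Inr (arev a)) x = 0"
      using x(2) by (metis InlI InrI)
    then show "g x a = y x a + y x (arev a)" "h x a = - (y x (rot a) + y x (rot (arev a)) + m x a)"
      using m(1)[OF a] by (auto simp: L_def g_def h_def)
  qed
  have "(\<Sum>a\<in>?A. (y x a + y x (arev a))\<^sup>2) = (\<Sum>a\<in>?A. (y x a + y x (arev a)) * g x a)"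
    using eq(1) by (simp add: power2_eq_square)
  also have "\<dots> = (\<Sum>a\<in>?A. (y x (rot a) + y x (rot (arev a)) + m x a) * h x a)"
    unfolding g_def h_def by (rule displacement_orthogonal) (use y u m k in auto)
  also have "\<dots> = - (\<Sum>a\<in>?A. (y x (rot a) + y x (rot (arev a)) + m x a)\<^sup>2)"
    unfolding sum_negf[symmetric]
    by (rule sum.cong) (simp_all add: eq(2) power2_eq_square del: minus_add_distrib)
  finally have sums: "(\<Sum>a\<in>?A. (y x a + y x (arev a))\<^sup>2)
      = - (\<Sum>a\<in>?A. (y x (rot a) + y x (rot (arev a)) + m x a)\<^sup>2)" .
  have nonneg: "(\<Sum>a\<in>?A. (y x a + y x (arev a))\<^sup>2) \<ge> 0"
    "(\<Sum>a\<in>?A. (y x (rot a) + y x (rot (arev a)) + m x a)\<^sup>2) \<ge> 0" by (auto intro: sum_nonneg)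
  have "(\<Sum>a\<in>?A. (y x a + y x (arev a))\<^sup>2) = 0"
    "(\<Sum>a\<in>?A. (y x (rot a) + y x (rot (arev a)) + m x a)\<^sup>2) = 0" using sums nonneg by linarith+
  then have ym: "y x a + y x (arev a) = 0" "y x (rot a) + y x (rot (arev a)) + m x a = 0"
    if "a \<in> ?A" for a using that by (auto simp: sum_nonneg_eq_0_iff)
  have "g x a = 0" "h x a = 0" if "a \<in> ?A" for a
    using that ym eq by auto
  note uk = this[unfolded g_def h_def]
  have zero: "y x a = 0" "m x a = 0" "u x a = 0" "k x a = 0" if "a \<in> ?A" for a
    using face_displacement_injective[of "y x" "m x" a, OF y ym irr that]
      vertex_displacement_injective[of "u x" "k x" a, OF u k uk irr that] by blast+
  \<comment> \<open>Every coordinate of \<open>x\<close> is the value of \<open>y\<close>,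
    \<open>u\<close>, \<open>m\<close> or \<open>k\<close> at some arc.\<close>
  have "x i = 0" if "i \<in> ?I" for i
    using that
  proof (elim PlusE)
    fix l a assume "i = Inl l" "l = Inl a" "a \<in> Y"
    then show ?thesis using zero(1)[of a] Y(1) by (auto simp: y_def)
  next
    fix l a assume "i = Inl l" "l = Inr a" "a \<in> U"
    then show ?thesis using zero(3)[of a] U(1) by (auto simp: u_def)
  next
    fix l C assume "i = Inr l" "l = Inl C" "C \<in> ?Z"
    then show ?thesis using zero(2) by (auto simp: m_def central_circuits_def)
  next
    fix l C assume "i = Inr l" "l = Inr C" "C \<in> ?Z"
    then show ?thesis using zero(4) by (auto simp: k_def central_circuits_def)
  qed
  with x(1) show False by blast
qed

end

section \<open>Hedrites given by tables\<close>

text \<open>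
  The four arcs leaving the vertex \<open>v\<close> are \<open>4 * v\<close> to \<open>4 * v + 3\<close> in cyclic order, and \<open>L\<close>
  lists the reverse arcs. The list \<open>K\<close> gives the number of the central circuit of each arc.
\<close>

definition partner :: "nat list \<Rightarrow> nat \<Rightarrow> nat" where
  "partner L a = (if a < length L then L ! a else a)"

definition next_arc :: "nat \<Rightarrow> nat" where
  "next_arc a = 4 * (a div 4) + Suc a mod 4"

abbreviation "table_face_step L \<equiv> face_step (partner L) next_arc"

text \<open>The value 0 flags a walk that closes after none of 2, 3 or 4 steps. A walk of length 1
  would come from a loop, which \<open>good_arc\<close> excludes.\<close>

definition sides :: "nat list \<Rightarrow> nat \<Rightarrow> nat" where
  "sides L a =
    (if table_face_step L (table_face_step L a) = a then 2
     else if table_face_step L (table_face_step L (table_face_step L a)) = a then 3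
     else if table_face_step L (table_face_step L (table_face_step L (table_face_step L a))) = a then 4
     else 0)"

text \<open>A bounded form of irreducibility: the rail from \<open>a\<close> leaves the 4-gons
  within the given number of steps. The bound 9 used in \<open>good_arc\<close> suffices for all
  five tables.\<close>

primrec rail_exits :: "nat list \<Rightarrow> nat \<Rightarrow> nat \<Rightarrow> bool" where
  "rail_exits L 0 a \<longleftrightarrow> sides L a \<noteq> 4"
| "rail_exits L (Suc n) a \<longleftrightarrow> sides L a \<noteq> 4 \<or> rail_exits L n (rail_step (partner L) next_arc a)"

text \<open>
  Local conditions replace global ones: \<open>partner L a < a\<close> at the first arc of each vertex yields
  connectedness, and distinct corners of every face exclude cut vertices.
\<close>

definition good_arc :: "nat list \<Rightarrow> nat list \<Rightarrow> nat \<Rightarrow> bool" where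
  "good_arc L K a \<longleftrightarrow>
     partner L a < length L \<and> partner L (partner L a) = a \<and> partner L a div 4 \<noteq> a div 4 \<and>
     (a mod 4 = 0 \<and> 0 < a \<longrightarrow> partner L a < a) \<and> sides L a \<noteq> 0 \<and>
     (sides L a = 4 \<longrightarrow> table_face_step L (table_face_step L a) div 4 \<noteq> a div 4) \<and>
     rail_exits L 9 a \<and>
     K ! partner L a = K ! a \<and> K ! straight_step (partner L) next_arc a = K ! a"

text \<open>Faces are counted by arcs, \<open>s\<close> for each \<open>s\<close>-gon, and these
  counts force Euler characteristic 2. The occurrence of \<open>i - 2\<close> numbers in
  \<open>K\<close> bounds the number of circuits from below.\<close>

definition is_hedrite_table :: "nat \<Rightarrow> nat list \<Rightarrow> nat list \<Rightarrow> bool" where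
  "is_hedrite_table i L K \<longleftrightarrow> length L mod 4 = 0 \<and> length K = length L \<and>
     list_all (good_arc L K) [0..<length L] \<and>
     length (filter (\<lambda>a. sides L a = 2) [0..<length L]) = 2 * (8 - i) \<and>
     length (filter (\<lambda>a. sides L a = 3) [0..<length L]) = 3 * (2 * i - 8) \<and>
     list_all (\<lambda>c. c \<in> set K) [0..<i - 2]"

text \<open>For a concrete list, simplification splits this equation into one rewrite rule per
  entry, so that tables are read without unfolding them. The next two lemmas serve likewise.\<close>

lemma nth_table: "xs = ys \<Longrightarrow> map (\<lambda>a. xs ! a) [0..<length ys] = ys"
  using map_nth by blast

lemma partner_table: "xs = ys \<Longrightarrow> map (\<lambda>a. partner xs a) [0..<length ys] = ys"
  by (rule nth_equalityI) (auto simp: partner_def)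

lemma face_table:
  "xs = ys \<Longrightarrow> map (\<lambda>a. table_face_step xs a) [0..<length ys] = map next_arc ys"
  by (rule nth_equalityI) (auto simp: partner_def face_step_def)

lemma rail_exits_numeral:
  "rail_exits L (numeral k) a \<longleftrightarrow>
     sides L a \<noteq> 4 \<or> rail_exits L (pred_numeral k) (rail_step (partner L) next_arc a)"
  unfolding numeral_eq_Suc[of k] by (rule rail_exits.simps)

lemma straight_step_table: "straight_step (partner L) next_arc a = next_arc (table_face_step L a)"
  by (simp add: straight_step_def face_step_def)

lemma upt_0_numeral: "[0..<numeral n] = 0 # [Suc 0..<numeral n]"
  by (rule upt_conv_Cons) simp

lemma upt_Suc_0_numeral:
  "[Suc 0..<numeral n] = (if Suc 0 < numeral n then Suc 0 # [2..<numeral n] else [])"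
  using upt_rec[of "Suc 0" "numeral n"] by (simp only: numeral_2_eq_2)

lemmas numeral_from_Suc = numeral_2_eq_2[symmetric] Suc_numeral arith_simps

lemmas table_eval = good_arc_def sides_def rail_exits_numeral rail_step_def straight_step_table
  next_arc_def numeral_2_eq_2[symmetric] upt_0_numeral upt_Suc_0_numeral

section \<open>From a table to a combinatorial map\<close>

locale hedrite_table =
  fixes i :: nat and L K :: "nat list"
  assumes table: "is_hedrite_table i L K" and i_bounds: "4 \<le> i" "i \<le> 8"
begin

abbreviation "p \<equiv> partner L"
abbreviation "f \<equiv> table_face_step L"
abbreviation "A \<equiv> {..<length L}"
definition "n = length L div 4"

definition G :: "(nat, nat) pre_digraph" where
  "G = \<lparr>verts = {..<n}, arcs = A, tail = (\<lambda>a. a div 4), head = (\<lambda>a. p a div 4)\<rparr>"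

lemma G_simps [simp]:
  "verts G = {..<n}" "arcs G = A" "tail G a = a div 4" "head G a = p a div 4"
  by (simp_all add: G_def)

lemma length_eq_4_n: "length L = 4 * n"
  using table by (auto simp: is_hedrite_table_def n_def)

lemma good_arcs: "a \<in> A \<Longrightarrow> good_arc L K a"
  using table by (simp add: is_hedrite_table_def list_all_iff)

lemma partner_less [simp]: "a \<in> A \<Longrightarrow> p a < length L"
  and partner_partner [simp]: "a \<in> A \<Longrightarrow> p (p a) = a"
  and no_loop: "a \<in> A \<Longrightarrow> p a div 4 \<noteq> a div 4"
  and partner_decreases: "a \<in> A \<Longrightarrow> a mod 4 = 0 \<Longrightarrow> 0 < a \<Longrightarrow> p a < a"
  and sides_neq_0: "a \<in> A \<Longrightarrow> sides L a \<noteq> 0"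
  and quadrangle_corners: "a \<in> A \<Longrightarrow> sides L a = 4 \<Longrightarrow> f (f a) div 4 \<noteq> a div 4"
  and rails_exit: "a \<in> A \<Longrightarrow> rail_exits L 9 a"
  and colour_partner: "a \<in> A \<Longrightarrow> K ! p a = K ! a"
  and colour_straight: "a \<in> A \<Longrightarrow> K ! straight_step p next_arc a = K ! a"
  by (use good_arcs[of a, unfolded good_arc_def] in metis)+

lemma partner_neq: "a \<in> A \<Longrightarrow> p a \<noteq> a"
  using no_loop by metis

lemma next_arc_div [simp]: "next_arc a div 4 = a div 4"
  by (simp add: next_arc_def)

lemma div_4_less [simp]: "a < length L \<Longrightarrow> a div 4 < n"
  by (simp add: length_eq_4_n less_mult_imp_div_less mult.commute)

lemma next_arc_less [simp]: "a < length L \<Longrightarrow> next_arc a < length L"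
  using div_less_iff_less_mult[of 4 _ n] by (metis div_4_less length_eq_4_n mult.commute next_arc_div zero_less_numeral)

lemma next_arc_add: "r < 4 \<Longrightarrow> next_arc (4 * v + r) = 4 * v + Suc r mod 4"
  by (simp add: next_arc_def flip: add_Suc_right)

lemma inj_next_arc:
  assumes "next_arc a = next_arc b"
  shows "a = b"
proof -
  have "a div 4 = b div 4" using assms next_arc_div by metis
  then have "Suc a mod 4 = Suc b mod 4" using assms by (simp add: next_arc_def)
  then have "a mod 4 = b mod 4" by (auto simp: mod_Suc split: if_splits)
  with \<open>a div 4 = b div 4\<close> show ?thesis by (metis div_mult_mod_eq)
qed

lemma face_step_div: "f a div 4 = p a div 4"
  by (simp add: face_step_def)

lemma face_step_less [simp]: "a < length L \<Longrightarrow> f a < length L"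
  by (simp add: face_step_def)

lemma face_step_eqD: "a \<in> A \<Longrightarrow> b \<in> A \<Longrightarrow> f a = f b \<Longrightarrow> a = b"
  using inj_next_arc[of "p a" "p b"] partner_partner by (metis face_step_def)

lemma inj_on_face_step: "inj_on f A"
  using face_step_eqD by (auto intro: inj_onI)

lemma face_step_neq: "a \<in> A \<Longrightarrow> f a \<noteq> a"
  using face_step_div no_loop by metis

lemma sides_cases:
  assumes a: "a \<in> A"
  obtains (2) "sides L a = 2" "f (f a) = a" | (3) "sides L a = 3" "f (f (f a)) = a" "f (f a) \<noteq> a"
    | (4) "sides L a = 4" "f (f (f (f a))) = a" "f (f a) \<noteq> a" "f (f (f a)) \<noteq> a"
  using sides_neq_0[OF a] by (auto simp: sides_def split: if_splits)

lemma sides_in: "a < length L \<Longrightarrow> sides L a \<in> {2, 3, 4}"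
  using sides_cases[of a] by auto

text \<open>Consecutive arcs of the walk differ because there are no loops; the other arcs differ by
  the failed tests in \<open>sides\<close> and by injectivity of \<open>f\<close>.\<close>

lemma card_face: "card (face p next_arc a) = sides L a" if a: "a \<in> A"
  using a
proof (cases rule: sides_cases)
  case 2
  then show ?thesis using orbit_eq_pair[of f a] face_step_neq[OF a] by (simp add: face_def)
next
  case 3
  have "orbit f a = {a, f a, f (f a)}"
    using orbit_eq_map_upt[of 3 f a] 3 by (simp add: numeral_3_eq_3)
  moreover have "f a \<noteq> f (f a)" using face_step_neq[of "f a"] a by simp
  ultimately show ?thesis using 3 face_step_neq[OF a] by (simp add: face_def)
next
  case 4
  have "orbit f a = {a, f a, f (f a), f (f (f a))}"
    using orbit_eq_map_upt[of 4 f a] 4 by (simp add: eval_nat_numeral)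
  moreover have "f a \<noteq> f (f a)" "f (f a) \<noteq> f (f (f a))"
    using face_step_neq[of "f a"] face_step_neq[of "f (f a)"] a by simp_all
  moreover have "f a \<noteq> f (f (f a))" using face_step_eqD[of a "f (f a)"] 4 a by auto
  ultimately show ?thesis using 4 face_step_neq[OF a] by (simp add: face_def)
qed

lemma sides_face_step: "sides L (f a) = sides L a" if a: "a \<in> A"
  using card_face[OF a] card_face[of "f a"]
    self_in_orbit_step[OF self_in_orbit_if_inj_on[of A f a]] inj_on_face_step a
  by (auto simp: face_def image_subset_iff)

lemma out_arcs_G: "out_arcs G v = orbit next_arc (4 * v)" if "v < n"
proof -
  have f: "next_arc (4 * v) = 4 * v + 1" "next_arc (4 * v + 1) = 4 * v + 2"
    "next_arc (4 * v + 2) = 4 * v + 3" "next_arc (4 * v + 3) = 4 * v"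
    using next_arc_add[of 0 v] next_arc_add[of 1 v] next_arc_add[of 2 v] next_arc_add[of 3 v] by simp_all
  have "orbit next_arc (4 * v) = {4 * v, 4 * v + 1, 4 * v + 2, 4 * v + 3}"
    using orbit_eq_map_upt[of "Suc (Suc (Suc (Suc 0)))" next_arc "4 * v"] f by simp
  moreover have "out_arcs G v = {4 * v, 4 * v + 1, 4 * v + 2, 4 * v + 3}"
  proof (intro equalityI subsetI)
    fix a assume "a \<in> out_arcs G v"
    then have "a div 4 = v" by simp
    moreover have "a = 4 * (a div 4) + a mod 4" "a mod 4 < 4" by simp_all
    ultimately have "a = 4 * v \<or> a = 4 * v + 1 \<or> a = 4 * v + 2 \<or> a = 4 * v + 3" by linarith
    then show "a \<in> {4 * v, 4 * v + 1, 4 * v + 2, 4 * v + 3}" by simp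
  next
    fix a assume "a \<in> {4 * v, 4 * v + 1, 4 * v + 2, 4 * v + 3}"
    then have "a div 4 = v \<and> a < 4 * n" using that by auto
    then show "a \<in> out_arcs G v" using length_eq_4_n by simp
  qed
  ultimately show ?thesis by simp
qed

lemma card_out_arcs: "card (out_arcs G v) = 4" if "v < n"
proof -
  have "out_arcs G v = {4 * v..<4 * v + 4}"
    using that length_eq_4_n by auto
  then show ?thesis by simp
qed

sublocale fin_digraph G
  by unfold_locales auto

text \<open>In a \<open>bidirected_digraph\<close> the arcs are exactly the points moved by the
  reversal, hence the default value of \<open>partner\<close>.\<close>

lemma partner_outside: "a \<notin> A \<Longrightarrow> p a = a"
  by (simp add: partner_def)

sublocale bidirected_digraph G p
  using partner_outside partner_neq by unfold_locales auto

section \<open>Connectedness and absence of cut vertices\<close>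

lemma dominates_G: "(a div 4) \<rightarrow>\<^bsub>G\<^esub> (p a div 4)" if "a \<in> A"
  using that by (intro dominatesI[of a]) (auto simp: arc_to_ends_def)

lemma symmetric_G: "symmetric G"
  by (rule sym_digraph.sym_arcs) unfold_locales

text \<open>For \<open>i < 8\<close> there is a 2-gon, for \<open>i = 8\<close> a 3-gon.\<close>

lemma n_pos: "0 < n"
proof -
  have "length (filter (\<lambda>a. sides L a = 2) [0..<length L]) = 2 * (8 - i)"
    "length (filter (\<lambda>a. sides L a = 3) [0..<length L]) = 3 * (2 * i - 8)"
    using table by (auto simp: is_hedrite_table_def)
  then have "L \<noteq> []" using i_bounds by (cases "i = 8") auto
  then show ?thesis using length_eq_4_n by (cases n) auto
qed

lemma reachable_0: "v < n \<Longrightarrow> v \<rightarrow>\<^sup>*\<^bsub>G\<^esub> 0"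
proof (induction v rule: less_induct)
  case (less v)
  show ?case
  proof (cases "v = 0")
    case False
    have a: "4 * v \<in> A" using less.prems length_eq_4_n by simp
    have "p (4 * v) < 4 * v" using partner_decreases[OF a] False by simp
    then have "p (4 * v) div 4 < v" by (simp add: div_less_iff_less_mult mult.commute)
    then show ?thesis
      using less.IH[of "p (4 * v) div 4"] less.prems dominates_G[OF a] by (auto intro: adj_reachable_trans)
  qed (use n_pos in auto)
qed

lemma reachable_G: "u < n \<Longrightarrow> v < n \<Longrightarrow> u \<rightarrow>\<^sup>*\<^bsub>G\<^esub> v"
  using reachable_0 symmetric_reachable[OF symmetric_G] reachable_trans by blast

lemma connected_G: "connected G"
  unfolding connected_def
  using n_pos reachable_G reachable_mk_symmetricI
  by (intro strongly_connectedI) (auto simp: mk_symmetric_def)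

text \<open>
  The heads of consecutive arcs at \<open>v\<close> are joined, avoiding \<open>v\<close>, along the boundary of the face
  between these arcs.
\<close>

lemma no_cut_vertex_G: "\<not> cut_vertex G v"
proof
  assume "cut_vertex G v"
  then obtain u w where u: "u < n" "u \<noteq> v" and w: "w < n" "w \<noteq> v"
    and uw: "u \<rightarrow>\<^sup>*\<^bsub>G\<^esub> w" "\<not> u \<rightarrow>\<^sup>*\<^bsub>del_vert v\<^esub> w"
    by (auto simp: cut_vertex_def)
  interpret H: wf_digraph "del_vert v" by (rule wf_digraph_del_vert)
  have H_adj: "(a div 4) \<rightarrow>\<^bsub>del_vert v\<^esub> (f a div 4)" "(f a div 4) \<rightarrow>\<^bsub>del_vert v\<^esub> (a div 4)"
    if "a \<in> A" "a div 4 \<noteq> v" "f a div 4 \<noteq> v" for a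
    using that H.dominatesI[of a "a div 4" "f a div 4"] H.dominatesI[of "p a" "f a div 4" "a div 4"]
    by (simp_all add: arc_to_ends_def del_vert_simps face_step_div)
  have turn: "u \<rightarrow>\<^sup>*\<^bsub>del_vert v\<^esub> (p (next_arc a) div 4)"
    if a: "a \<in> A" "a div 4 = v" and reach: "u \<rightarrow>\<^sup>*\<^bsub>del_vert v\<^esub> (p a div 4)" for a
  proof -
    let ?c = "p a"
    have c: "?c \<in> A" "f ?c = next_arc a" "?c div 4 \<noteq> v"
      using a no_loop[of a] by (auto simp: face_step_def)
    have b: "f ?c \<in> A" "f ?c div 4 = v" using c a by simp_all
    have ffc: "f (f ?c) div 4 = p (next_arc a) div 4" using c face_step_div by metis
    have ffc_v: "f (f ?c) div 4 \<noteq> v" using ffc no_loop[of "next_arc a"] a by simp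
    from c(1) show ?thesis
    proof (cases rule: sides_cases)
      case 2
      then show ?thesis using ffc reach by simp
    next
      case 3
      have "(?c div 4) \<rightarrow>\<^bsub>del_vert v\<^esub> (f (f ?c) div 4)"
        using H_adj(2)[of "f (f ?c)"] 3 a c ffc_v by simp
      then show ?thesis using reach ffc H.reachable_adj_trans by metis
    next
      case 4
      \<comment> \<open>The path follows the two sides of the 4-gon away from \<open>v\<close>; its
        middle vertex is the corner opposite to \<open>v\<close>, which is where
        \<open>quadrangle_corners\<close> is required.\<close>
      have "sides L (f ?c) = 4" using sides_face_step[OF c(1)] 4 by simp
      then have "f (f (f ?c)) div 4 \<noteq> v" using quadrangle_corners[of "f ?c"] b by simp
      moreover have "f (f ?c) \<in> A" "f (f (f ?c)) \<in> A" using c(1) by simp_all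
      moreover have "f (f (f (f ?c))) div 4 \<noteq> v" using 4 c(3) by metis
      ultimately have "(f (f (f (f ?c))) div 4) \<rightarrow>\<^bsub>del_vert v\<^esub> (f (f (f ?c)) div 4)"
        "(f (f (f ?c)) div 4) \<rightarrow>\<^bsub>del_vert v\<^esub> (f (f ?c) div 4)"
        using H_adj(2) ffc_v by blast+
      then show ?thesis using reach ffc 4(2) H.reachable_adj_trans by metis
    qed
  qed
  \<comment> \<open>Turning step by step around \<open>v\<close>: once one neighbour is reached
    avoiding \<open>v\<close>, all are.\<close>
  have around: "u \<rightarrow>\<^sup>*\<^bsub>del_vert v\<^esub> (p b div 4)"
    if a: "a \<in> A" "a div 4 = v" "u \<rightarrow>\<^sup>*\<^bsub>del_vert v\<^esub> (p a div 4)" and b: "b \<in> A" "b div 4 = v" for a b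
  proof -
    have v: "v < n" using a(1,2) div_4_less[of a] by simp
    have "a \<in> orbit next_arc (4 * v)" "b \<in> orbit next_arc (4 * v)"
      using a(1,2) b unfolding out_arcs_G[OF v, symmetric] by auto
    moreover have "4 * v \<in> orbit next_arc (4 * v)"
      using v length_eq_4_n unfolding out_arcs_G[OF v, symmetric] by auto
    ultimately have "b \<in> orbit next_arc a" by (meson orbit_swap orbit_trans)
    then have "b \<in> A \<and> b div 4 = v \<and> u \<rightarrow>\<^sup>*\<^bsub>del_vert v\<^esub> (p b div 4)"
    proof induct
      case base
      then show ?case using a turn by simp
    next
      case (step y)
      then show ?case using turn[of y] by simp
    qed
    then show ?thesis by simp
  qed
  \<comment> \<open>Invariant along a walk of \<open>G\<close> from \<open>u\<close>: while the walk
    stands at \<open>v\<close>, the claim is that all neighbours of \<open>v\<close> are reachable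
    avoiding it, so the walk can continue from any of them.\<close>
  have "(x \<noteq> v \<longrightarrow> u \<rightarrow>\<^sup>*\<^bsub>del_vert v\<^esub> x) \<and>
      (x = v \<longrightarrow> (\<forall>a\<in>A. a div 4 = v \<longrightarrow> u \<rightarrow>\<^sup>*\<^bsub>del_vert v\<^esub> (p a div 4)))"
    if "u \<rightarrow>\<^sup>*\<^bsub>G\<^esub> x" for x
    using that
  proof (induction rule: reachable_induct)
    case base
    then show ?case using u by (auto simp: del_vert_simps)
  next
    case (step x y)
    from step.hyps(2) obtain a where a: "a \<in> A" "a div 4 = x" "p a div 4 = y" by auto
    consider "x = v" | "x \<noteq> v" "y = v" | "x \<noteq> v" "y \<noteq> v" by blast
    then show ?case
    proof cases
      case 1
      then have "y \<noteq> v" using a no_loop[OF a(1)] by auto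
      then show ?thesis using 1 a step.IH by auto
    next
      case 2
      then have "u \<rightarrow>\<^sup>*\<^bsub>del_vert v\<^esub> (p (p a) div 4)" using step.IH a by simp
      then show ?thesis using around[of "p a"] a 2 by auto
    next
      case 3
      have "x \<rightarrow>\<^bsub>del_vert v\<^esub> y"
        using H_adj(1)[OF a(1)] a 3 by (simp add: face_step_div)
      then show ?thesis using 3 step.IH H.reachable_adj_trans by blast
    qed
  qed
  with uw w show False by blast
qed

section \<open>Face counts and the Euler characteristic\<close>

lemma card_sides:
  "card {a \<in> A. sides L a = 2} = 2 * (8 - i)" "card {a \<in> A. sides L a = 3} = 3 * (2 * i - 8)"
proof -
  have "card {a \<in> A. P a} = length (filter P [0..<length L])" for P
  proof -
    have "{a \<in> A. P a} = set (filter P [0..<length L])" by auto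
    then show ?thesis using distinct_card[of "filter P [0..<length L]"] by simp
  qed
  then show "card {a \<in> A. sides L a = 2} = 2 * (8 - i)"
    "card {a \<in> A. sides L a = 3} = 3 * (2 * i - 8)"
    using table by (simp_all add: is_hedrite_table_def)
qed

lemma card_faces_size: "s * card {F \<in> faces G p next_arc. card F = s} = card {a \<in> A. sides L a = s}"
proof -
  have "s * card {F \<in> faces G p next_arc. card F = s} = card {a \<in> A. card (orbit f a) = s}"
    using sum_card_orbits[of A f "\<lambda>F. card F = s"] inj_on_face_step
    by (auto simp: faces_def face_def[abs_def] mult.commute image_subset_iff)
  also have "{a \<in> A. card (orbit f a) = s} = {a \<in> A. sides L a = s}"
    using card_face by (auto simp: face_def)
  finally show ?thesis .
qed

lemma face_sizes_G: "F \<in> faces G p next_arc \<Longrightarrow> card F \<in> {2, 3, 4}"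
proof -
  assume "F \<in> faces G p next_arc"
  then obtain a where "a < length L" "F = face p next_arc a" by (auto simp: faces_def)
  then show "card F \<in> {2, 3, 4}" using card_face[of a] sides_in[of a] by simp
qed

lemma card_digons_G: "card {F \<in> faces G p next_arc. card F = 2} = 8 - i"
  using card_faces_size[of 2] card_sides(1) by simp

text \<open>The arcs left over by the 2-gons and 3-gons bound \<open>n + 2 - i\<close> 4-gons, which
  gives \<open>n + 2\<close> faces against \<open>2 * n\<close> edges.\<close>

lemma euler_G: "int (card (verts G)) - int (card (edges G p)) + int (card (faces G p next_arc)) = 2"
proof -
  have "card A = 2 * card (edges G p)"
    unfolding edges_def G_simps by (rule card_edge_image) (use partner_neq in auto)
  moreover have "card A = card {a \<in> A. sides L a = 2} + card {a \<in> A. sides L a = 3}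
      + card {a \<in> A. sides L a = 4}"
    by (rule card_partition_2_3_4) (use sides_in in auto)
  moreover have "card (faces G p next_arc) = card {F \<in> faces G p next_arc. card F = 2}
      + card {F \<in> faces G p next_arc. card F = 3} + card {F \<in> faces G p next_arc. card F = 4}"
    by (rule card_partition_2_3_4) (use face_sizes_G in \<open>auto simp: faces_def\<close>)
  moreover have "card (verts G) = n" "card A = 4 * n" using length_eq_4_n by simp_all
  ultimately show ?thesis
    using card_sides card_faces_size[of 3] card_faces_size[of 4] card_digons_G i_bounds by linarith
qed

sublocale hedrite i G p next_arc
proof unfold_locales
  show "connected G" by (rule connected_G)
  show "cyclic_on next_arc (out_arcs G v)" if "v \<in> verts G" for v
  proof -
    have "4 * v \<in> out_arcs G v" using that length_eq_4_n by simp
    then show ?thesis using out_arcs_G[of v] that unfolding cyclic_on_def by auto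
  qed
  show "int (card (verts G)) - int (card (edges G p)) + int (card (faces G p next_arc)) = 2"
    by (rule euler_G)
  show "i \<in> {4..8}" using i_bounds by simp
  show "\<not> cut_vertex G v" for v by (rule no_cut_vertex_G)
  show "out_degree G v = 4" if "v \<in> verts G" for v
    using that card_out_arcs by (simp add: out_degree_def)
  show "card F \<in> {2, 3, 4}" if "F \<in> faces G p next_arc" for F using that by (rule face_sizes_G)
  show "card {F \<in> faces G p next_arc. card F = 2} = 8 - i" by (rule card_digons_G)
qed

text \<open>A rail-road is closed under rail steps and meets only 4-gons, so
  \<open>rail_exits\<close> would fail on it for every bound.\<close>

lemma irreducible_G: "irreducible_map G p next_arc"
  unfolding irreducible_map_def
proof
  assume "\<exists>as. rail_road G p next_arc as"
  then obtain as where as: "as \<noteq> []" "set as \<subseteq> A" "\<And>a. a \<in> set as \<Longrightarrow> card (face p next_arc a) = 4"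
    "\<And>j. j < length as \<Longrightarrow> as ! (Suc j mod length as) = rail_step p next_arc (as ! j)"
    by (auto simp: rail_road_def)
  have step: "rail_step p next_arc a \<in> set as" if "a \<in> set as" for a
    using that as(1,4) by (metis in_set_conv_nth length_greater_0_conv mod_less_divisor)
  have "\<not> rail_exits L k a" if "a \<in> set as" for k a
    using that
  proof (induction k arbitrary: a)
    case 0
    then show ?case using as(2) as(3)[of a] card_face[of a] by auto
  next
    case (Suc k)
    then show ?case using as(2) as(3)[of a] card_face[of a] step by auto
  qed
  moreover have "hd as \<in> set as" using as(1) by simp
  ultimately show False using rails_exit as(2) by blast
qed

text \<open>\<open>K\<close> is constant on each circuit, so it induces a map on circuits, and this
  map hits all of \<open>{..<i - 2}\<close>.\<close>

lemma card_central_circuits_ge: "i - 2 \<le> card (central_circuits G p next_arc)"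
proof -
  let ?colour = "\<lambda>C. the_elem ((!) K ` \<Union> C)"
  have colour: "?colour (central_circuit p next_arc a) = K ! a" if a: "a \<in> A" for a
  proof -
    have "b \<in> A \<and> K ! b = K ! a" if "b \<in> orbit (straight_step p next_arc) a" for b
      using that
      by induct (use a colour_straight straight_step_in_arcs in auto)
    note orbit = this
    have "(!) K ` \<Union> (central_circuit p next_arc a) = {K ! a}"
    proof (intro equalityI subsetI)
      fix x assume "x \<in> (!) K ` \<Union> (central_circuit p next_arc a)"
      then obtain b where b: "b \<in> orbit (straight_step p next_arc) a" "x = K ! b \<or> x = K ! p b"
        by (auto simp: central_circuit_def edge_def)
      show "x \<in> {K ! a}" using b(2) orbit[OF b(1)] colour_partner[of b] by auto
    next
      fix x assume "x \<in> {K ! a}"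
      then show "x \<in> (!) K ` \<Union> (central_circuit p next_arc a)"
        using straight_self_in_orbit[of a] a by (auto simp: central_circuit_def edge_def)
    qed
    then show ?thesis by simp
  qed
  have "{..<i - 2} \<subseteq> ?colour ` central_circuits G p next_arc"
  proof
    fix c assume "c \<in> {..<i - 2}"
    then have "c \<in> set K" using table by (simp add: is_hedrite_table_def list_all_iff)
    moreover have "length K = length L" using table by (simp add: is_hedrite_table_def)
    ultimately obtain a where a: "a \<in> A" "K ! a = c" by (metis in_set_conv_nth lessThan_iff)
    then have "c = ?colour (central_circuit p next_arc a)" using colour by simp
    then show "c \<in> ?colour ` central_circuits G p next_arc"
      unfolding central_circuits_def using a(1) by (intro image_eqI) auto
  qed
  then have "card {..<i - 2} \<le> card (central_circuits G p next_arc)"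
    by (intro surj_card_le) (auto simp: central_circuits_def)
  then show ?thesis by simp
qed

lemma exists_extremal_hedrite:
  "\<exists>(G :: (nat, nat) pre_digraph) arev rot. hedrite i G arev rot \<and> irreducible_map G arev rot \<and>
     card (central_circuits G arev rot) = i - 2"
  using hedrite_axioms irreducible_G card_central_circuits_ge card_central_circuits_le[OF irreducible_G]
  by (meson le_antisym)

end

section \<open>Extremal hedrites\<close>

text \<open>Two vertices joined by four edges, with four 2-gons as faces.\<close>

definition partners4 :: "nat list" where
  "partners4 =
   [4, 7, 6, 5, 0, 3, 2, 1]"

definition circuits4 :: "nat list" where
  "circuits4 =
   [0, 1, 0, 1, 0, 1, 0, 1]"

lemma length_table4: "length partners4 = 8" "length circuits4 = 8"
  by (simp_all add: partners4_def circuits4_def)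

text \<open>Membership is settled here from the explicit list, since the check of the table keeps
  \<open>circuits4\<close> folded. The larger tables follow the same pattern.\<close>

lemma circuit_numbers4: "list_all (\<lambda>c. c \<in> set circuits4) [0, 1]"
  by (simp add: circuits4_def)

lemmas lookup4 =
  partner_table[OF partners4_def, simplified, simplified numeral_from_Suc]
  face_table[OF partners4_def, simplified list.map next_arc_def, simplified,
    simplified numeral_from_Suc]
  nth_table[OF circuits4_def, simplified, simplified numeral_from_Suc]

lemma is_hedrite_table4: "is_hedrite_table 4 partners4 circuits4"
  using circuit_numbers4
  by (simp add: is_hedrite_table_def length_table4 lookup4 table_eval cong: if_weak_cong)

definition partners5 :: "nat list" where
  "partners5 =
   [4, 7, 8, 16, 0, 20, 13, 1, 2, 12, 15, 17, 9, 6, 23, 10, 3, 11, 22, 21, 5, 19, 18, 14]"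

definition circuits5 :: "nat list" where
  "circuits5 =
   [0, 1, 0, 1, 0, 1, 0, 1, 0, 2, 0, 2, 2, 0, 2, 0, 1, 2, 1, 2, 1, 2, 1, 2]"

lemma length_table5: "length partners5 = 24" "length circuits5 = 24"
  by (simp_all add: partners5_def circuits5_def)

lemma circuit_numbers5: "list_all (\<lambda>c. c \<in> set circuits5) [0, 1, 2]"
  by (simp add: circuits5_def)

lemmas lookup5 =
  partner_table[OF partners5_def, simplified, simplified numeral_from_Suc]
  face_table[OF partners5_def, simplified list.map next_arc_def, simplified,
    simplified numeral_from_Suc]
  nth_table[OF circuits5_def, simplified, simplified numeral_from_Suc]

lemma is_hedrite_table5: "is_hedrite_table 5 partners5 circuits5"
  using circuit_numbers5
  by (simp add: is_hedrite_table_def length_table5 lookup5 table_eval cong: if_weak_cong)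

definition partners6 :: "nat list" where
  "partners6 =
   [4, 7, 8, 16, 0, 20, 13, 1, 2, 12, 32, 29, 9, 6, 24, 37, 3, 28, 40, 21, 5, 19, 44, 25,
    14, 23, 47, 38, 17, 11, 35, 41, 10, 36, 52, 30, 33, 15, 27, 48, 18, 31, 55, 45, 22, 43,
    49, 26, 39, 46, 54, 53, 34, 51, 50, 42]"

definition circuits6 :: "nat list" where
  "circuits6 =
   [0, 1, 0, 1, 0, 1, 0, 1, 0, 2, 0, 2, 2, 0, 2, 0, 1, 3, 1, 3, 1, 3, 1, 3, 2, 3, 2, 3, 3,
    2, 3, 2, 0, 3, 0, 3, 3, 0, 3, 0, 1, 2, 1, 2, 1, 2, 1, 2, 0, 1, 0, 1, 0, 1, 0, 1]"

lemma length_table6: "length partners6 = 56" "length circuits6 = 56"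
  by (simp_all add: partners6_def circuits6_def)

lemma circuit_numbers6: "list_all (\<lambda>c. c \<in> set circuits6) [0, 1, 2, 3]"
  by (simp add: circuits6_def)

lemmas lookup6 =
  partner_table[OF partners6_def, simplified, simplified numeral_from_Suc]
  face_table[OF partners6_def, simplified list.map next_arc_def, simplified,
    simplified numeral_from_Suc]
  nth_table[OF circuits6_def, simplified, simplified numeral_from_Suc]

lemma is_hedrite_table6: "is_hedrite_table 6 partners6 circuits6"
  using circuit_numbers6
  by (simp add: is_hedrite_table_def length_table6 lookup6 table_eval cong: if_weak_cong)

definition partners7 :: "nat list" where
  "partners7 =
   [4, 8, 16, 5, 0, 3, 20, 13, 1, 12, 32, 29, 9, 7, 24, 41, 2, 28, 48, 21, 6, 19, 52, 25,
    14, 23, 56, 45, 17, 11, 36, 65, 10, 40, 72, 37, 30, 35, 76, 69, 33, 15, 44, 81, 42, 27,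
    60, 85, 18, 64, 88, 53, 22, 51, 92, 57, 26, 55, 96, 61, 46, 59, 99, 86, 49, 31, 68, 119,
    66, 39, 79, 116, 34, 80, 108, 77, 38, 75, 112, 70, 73, 43, 84, 104, 82, 47, 63, 100, 50,
    118, 120, 93, 54, 91, 124, 97, 58, 95, 101, 62, 87, 98, 127, 105, 83, 103, 126, 109, 74,
    107, 122, 113, 78, 111, 121, 117, 71, 115, 89, 67, 90, 114, 110, 125, 94, 123, 106, 102]"

definition circuits7 :: "nat list" where
  "circuits7 =
   [0, 0, 0, 0, 0, 0, 0, 0, 0, 1, 0, 1, 1, 0, 1, 0, 0, 2, 0, 2, 0, 2, 0, 2, 1, 2, 1, 2, 2,
    1, 2, 1, 0, 3, 0, 3, 2, 3, 2, 3, 3, 0, 3, 0, 3, 2, 3, 2, 0, 4, 0, 4, 0, 4, 0, 4, 1, 4,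
    1, 4, 3, 4, 3, 4, 4, 1, 4, 1, 4, 3, 4, 3, 0, 4, 0, 4, 2, 4, 2, 4, 4, 0, 4, 0, 4, 2, 4,
    2, 0, 3, 0, 3, 0, 3, 0, 3, 1, 3, 1, 3, 2, 1, 2, 1, 0, 1, 0, 1, 0, 1, 0, 1, 2, 1, 2, 1,
    3, 1, 3, 1, 0, 2, 0, 2, 0, 2, 0, 2]"

lemma length_table7: "length partners7 = 128" "length circuits7 = 128"
  by (simp_all add: partners7_def circuits7_def)

lemma circuit_numbers7: "list_all (\<lambda>c. c \<in> set circuits7) [0, 1, 2, 3, 4]"
  by (simp add: circuits7_def)

lemmas lookup7 =
  partner_table[OF partners7_def, simplified, simplified numeral_from_Suc]
  face_table[OF partners7_def, simplified list.map next_arc_def, simplified,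
    simplified numeral_from_Suc]
  nth_table[OF circuits7_def, simplified, simplified numeral_from_Suc]

lemma is_hedrite_table7: "is_hedrite_table 7 partners7 circuits7"
  using circuit_numbers7
  by (simp add: is_hedrite_table_def length_table7 lookup7 table_eval cong: if_weak_cong)

definition partners8 :: "nat list" where
  "partners8 =
   [4, 8, 12, 20, 0, 24, 32, 9, 1, 7, 36, 17, 2, 16, 48, 29, 13, 11, 40, 53, 3, 28, 60, 25,
    5, 23, 64, 45, 21, 15, 51, 69, 6, 44, 80, 37, 10, 35, 84, 41, 18, 39, 87, 57, 33, 27,
    67, 108, 14, 52, 73, 30, 49, 19, 56, 77, 54, 43, 88, 78, 22, 68, 103, 65, 26, 63, 104,
    46, 61, 31, 72, 100, 70, 50, 76, 96, 74, 55, 59, 92, 34, 111, 113, 85, 38, 83, 89, 42,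
    58, 86, 112, 93, 79, 91, 116, 97, 75, 95, 119, 101, 71, 99, 105, 62, 66, 102, 118, 109,
    47, 107, 114, 81, 90, 82, 110, 117, 94, 115, 106, 98]"

definition circuits8 :: "nat list" where
  "circuits8 =
   [0, 1, 0, 1, 0, 2, 0, 2, 1, 2, 1, 2, 0, 3, 0, 3, 3, 2, 3, 2, 1, 4, 1, 4, 2, 4, 2, 4, 4,
    3, 4, 3, 0, 5, 0, 5, 1, 5, 1, 5, 3, 5, 3, 5, 5, 4, 5, 4, 0, 4, 0, 4, 4, 2, 4, 2, 4, 5,
    4, 5, 1, 5, 1, 5, 2, 5, 2, 5, 5, 3, 5, 3, 5, 0, 5, 0, 5, 2, 5, 2, 0, 3, 0, 3, 1, 3, 1,
    3, 4, 1, 4, 1, 2, 1, 2, 1, 0, 1, 0, 1, 3, 1, 3, 1, 2, 3, 2, 3, 4, 3, 4, 3, 4, 0, 4, 0,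
    2, 0, 2, 0]"

lemma length_table8: "length partners8 = 120" "length circuits8 = 120"
  by (simp_all add: partners8_def circuits8_def)

lemma circuit_numbers8: "list_all (\<lambda>c. c \<in> set circuits8) [0, 1, 2, 3, 4, 5]"
  by (simp add: circuits8_def)

lemmas lookup8 =
  partner_table[OF partners8_def, simplified, simplified numeral_from_Suc]
  face_table[OF partners8_def, simplified list.map next_arc_def, simplified,
    simplified numeral_from_Suc]
  nth_table[OF circuits8_def, simplified, simplified numeral_from_Suc]

lemma is_hedrite_table8: "is_hedrite_table 8 partners8 circuits8"
  using circuit_numbers8
  by (simp add: is_hedrite_table_def length_table8 lookup8 table_eval cong: if_weak_cong)

theorem theorem4:
  fixes i :: nat
  assumes "4 \<le> i" and "i \<le> 8"
  shows "(\<forall>(G :: ('a, 'b) pre_digraph) arev rot.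
            hedrite i G arev rot \<and> irreducible_map G arev rot
              \<longrightarrow> card (central_circuits G arev rot) \<le> i - 2) \<and>
         (\<exists>(G :: (nat, nat) pre_digraph) arev rot.
            hedrite i G arev rot \<and> irreducible_map G arev rot \<and>
              card (central_circuits G arev rot) = i - 2)"
proof (intro conjI allI impI)
  fix G :: "('a, 'b) pre_digraph" and arev rot
  assume "hedrite i G arev rot \<and> irreducible_map G arev rot"
  then show "card (central_circuits G arev rot) \<le> i - 2"
    using hedrite.card_central_circuits_le by blast
next
  have tables: "\<exists>L K. hedrite_table i L K"
  proof -
    consider "i = 4" | "i = 5" | "i = 6" | "i = 7" | "i = 8" using assms by linarith
    then show ?thesis
    proof cases
      case 1
      then show ?thesis using is_hedrite_table4 by (auto simp: hedrite_table_def)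
    next
      case 2
      then show ?thesis using is_hedrite_table5 by (auto simp: hedrite_table_def)
    next
      case 3
      then show ?thesis using is_hedrite_table6 by (auto simp: hedrite_table_def)
    next
      case 4
      then show ?thesis using is_hedrite_table7 by (auto simp: hedrite_table_def)
    next
      case 5
      then show ?thesis using is_hedrite_table8 by (auto simp: hedrite_table_def)
    qed
  qed
  then show "\<exists>(G :: (nat, nat) pre_digraph) arev rot.
      hedrite i G arev rot \<and> irreducible_map G arev rot \<and>
      card (central_circuits G arev rot) = i - 2"
    using hedrite_table.exists_extremal_hedrite by blast
qed

end
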